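(* Suppose that for every positive integer $n$ the bivariate polynomial \[ \mathrm{simp}_n(s,t)=\sum_{\sigma\in \mathrm{Simp}_n} s^{\mathrm{des}(\sigma)}t^{\mathrm{ides}(\sigma)} \] is gamma-positive (as a bivariate palindromic polynomial of darga $n-1$), where $\mathrm{Simp}_n$ is the set of simple permutations of length $n$. Then for each $n\ge 1$ there exist nonnegative integers $\gamma_{n,i,j}$ $(i,j\ge 0,\ 2i+j\le n-1)$ such that \[ \sum_{\pi\in S_n} s^{\mathrm{des}(\pi)}t^{\mathrm{ides}(\pi)}=\sum_{i,j\ge 0,\ 2i+j\le n-1}\gamma_{n,i,j}(st)^i(s+t)^j(1+st)^{n-1-j-2i}. \]
   Context: For $\pi \in S_n$ (written in one-line notation), $\mathrm{des}(\pi)=|\{i\in\{1,\dots,n-1\} : \pi(i)>\pi(i+1)\}|$ and $\mathrm{ides}(\pi)=\mathrm{des}(\pi^{-1})$. A block of a permutation $a_1\ldots a_n$ is a nonempty contiguous sequence of entries $a_i a_{i+1}\ldots a_{i+k}$ whose values also form a contiguous sequence of integers. Singletons and the whole permutation are trivial blocks; all other blocks are proper. A permutation is simple if it has no proper blocks (so $1$, $12$, $21$ are simple, and there are no simple permutations of length $3$). A bivariate polynomial $f(s,t)$ is palindromic of darga $n-1$ if $f(s,t)=(st)^{n-1}f(1/s,1/t)$ and $f(s,t)=f(t,s)$ (the zero polynomial is palindromic of every darga). These polynomials form a vector space with basis (the bivariate gamma basis) $\{(st)^i(s+t)^j(1+st)^{n-1-j-2i} : i,j\ge 0,\ 2i+j\le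 n-1\}$. Such a polynomial is gamma-positive if all its coefficients in this basis are nonnegative. *)

theory Defs
  imports "HOL-Combinatorics.Permutations" "HOL-Computational_Algebra.Polynomial"
begin

section \<open>Descents and simple permutations\<close>

text \<open>Elements of the symmetric group are functions \<open>\<pi> :: nat \<Rightarrow> nat\<close> with \<open>\<pi> permutes {1..n}\<close>.\<close>

definition des :: "nat \<Rightarrow> (nat \<Rightarrow> nat) \<Rightarrow> nat"
  where "des n \<pi> = card {i \<in> {1..n - 1}. \<pi> i > \<pi> (i + 1)}"

definition ides :: "nat \<Rightarrow> (nat \<Rightarrow> nat) \<Rightarrow> nat"
  where "ides n \<pi> = des n (inv \<pi>)"

text \<open>A block is given by its first and last positions \<open>i\<close> and \<open>j\<close>.\<close>

definition is_block :: "nat \<Rightarrow> (nat \<Rightarrow> nat) \<Rightarrow> nat \<Rightarrow> nat \<Rightarrow> bool"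
  where "is_block n \<pi> i j \<longleftrightarrow> 1 \<le> i \<and> i \<le> j \<and> j \<le> n \<and> (\<exists>a b. \<pi> ` {i..j} = {a..b})"

definition proper_block :: "nat \<Rightarrow> (nat \<Rightarrow> nat) \<Rightarrow> nat \<Rightarrow> nat \<Rightarrow> bool"
  where "proper_block n \<pi> i j \<longleftrightarrow> is_block n \<pi> i j \<and> i \<noteq> j \<and> \<not> (i = 1 \<and> j = n)"

definition Simp :: "nat \<Rightarrow> (nat \<Rightarrow> nat) set"
  where "Simp n = {\<sigma>. \<sigma> permutes {1..n} \<and> (\<nexists>i j. proper_block n \<sigma> i j)}"


section \<open>Bivariate polynomials\<close>

text \<open>Polynomials in \<open>s\<close> and \<open>t\<close> are elements of \<open>real poly poly\<close>, where \<open>s\<close> is the outer and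
  \<open>t\<close> the inner variable.\<close>

definition var_s :: "real poly poly"
  where "var_s = [:0, 1:]"

definition var_t :: "real poly poly"
  where "var_t = [:[:0, 1:]:]"

definition eval2 :: "real poly poly \<Rightarrow> real \<Rightarrow> real \<Rightarrow> real"
  where "eval2 f a b = poly (poly f [:a:]) b"

lemma eval2_simps [simp]:
  "eval2 var_s a b = a" "eval2 var_t a b = b" "eval2 [:[:c:]:] a b = c" "eval2 0 a b = 0" "eval2 1 a b = 1"
  "eval2 (f + g) a b = eval2 f a b + eval2 g a b"
  "eval2 (f * g) a b = eval2 f a b * eval2 g a b"
  "eval2 (f ^ k) a b = eval2 f a b ^ k"
  by (simp_all add: eval2_def var_s_def var_t_def)

text \<open>Over the infinite field of reals, formal identities in \<open>s\<close> and \<open>t\<close>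
  may be stated pointwise.\<close>

definition palindromic :: "nat \<Rightarrow> real poly poly \<Rightarrow> bool"
  where "palindromic d f \<longleftrightarrow>
    (\<forall>a b. a \<noteq> 0 \<longrightarrow> b \<noteq> 0 \<longrightarrow> eval2 f a b = (a * b) ^ d * eval2 f (1 / a) (1 / b)) \<and>
    (\<forall>a b. eval2 f a b = eval2 f b a)"

definition gamma_index :: "nat \<Rightarrow> (nat \<times> nat) set"
  where "gamma_index d = {(i, j). 2 * i + j \<le> d}"

lemma finite_gamma_index [simp]: "finite (gamma_index d)"
  by (rule finite_subset[of _ "{..d} \<times> {..d}"]) (auto simp: gamma_index_def)

definition gamma_basis :: "nat \<Rightarrow> nat \<Rightarrow> nat \<Rightarrow> real poly poly"
  where "gamma_basis d i j =
    (var_s * var_t) ^ i * (var_s + var_t) ^ j * (1 + var_s * var_t) ^ (d - j - 2 * i)"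

text \<open>The scalar \<open>c\<close> is embedded as the constant polynomial \<open>[:[:c:]:]\<close>.  Since the
  \<open>gamma_basis d i j\<close> with \<open>2 * i + j \<le> d\<close> are linearly independent, an expansion with nonnegative
  coefficients is the only expansion.\<close>

definition gamma_positive :: "nat \<Rightarrow> real poly poly \<Rightarrow> bool"
  where "gamma_positive d f \<longleftrightarrow> palindromic d f \<and>
    (\<exists>c. (\<forall>(i, j) \<in> gamma_index d. c i j \<ge> 0) \<and>
         f = (\<Sum>(i, j) \<in> gamma_index d. [:[:c i j:]:] * gamma_basis d i j))"

definition simp_poly :: "nat \<Rightarrow> real poly poly"
  where "simp_poly n = (\<Sum>\<sigma> \<in> Simp n. var_s ^ des n \<sigma> * var_t ^ ides n \<sigma>)"

end

(*
  Every permutation is x (length 1), an inflation of a simple permutation of length at least 4 by its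
  maximal proper blocks, a direct sum with indecomposable first summand, or a skew sum with
  skew-indecomposable first summand.  Descents and inverse descents add up under inflation.  With
  u = s t, F the generating function of all permutations by length, Y that of the first two kinds,
  and P, M those of direct and skew sums, this gives
    F = Y + P + M,   P = (F - P) F,   M = u (F - M) F.
  The signs in P = F^2 / (1 + F) and M = u F^2 / (1 + u F) disappear on elimination:
    F = Y + (1 + u) Y F + u Y F^2 + u F^3.
  Each coefficient of the right-hand side is a sum of products of gamma-positive polynomials of
  smaller length and of the right total darga, so nonnegativity follows by induction on the length.
  Integrality is automatic because the gamma basis is unitriangular over the integers.
*)

theory Submission
  imports Defs "HOL-Library.FuncSet" "HOL-Computational_Algebra.Formal_Power_Series"
begin

section \<open>Patterns and descents with respect to two linear orders\<close>

text \<open>Direct sums and skew sums do not behave well separately: in length 2 they contribute 1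
  and u, while only 1 + u is palindromic of darga 1. A product of two coefficients loses one unit of
  darga, and the weights 1 and u of the permutations 12 and 21 do not restore it. Clearing both
  denominators together pairs 1 with u, which yields the factor 1 + u of darga 1; products of three
  series lose two units, and u of darga 2 restores those. Sums need an argument of their own because
  a permutation can be an inflation of 12 or of 21 at several cuts. Choosing the first cut restores
  uniqueness and is the source of the factors F - P and F - M. Descents and inverse descents both
  count consecutive pairs in a finite set with two linear orders, and exchanging the orders
  exchanges the statistics. One counting lemma therefore serves both.\<close>

definition rank :: "'a set \<Rightarrow> ('a \<Rightarrow> nat) \<Rightarrow> 'a \<Rightarrow> nat"
  where "rank X f p = card {q \<in> X. f q \<le> f p}"

lemma rank_less_iff:
  assumes "finite X" "p \<in> X" "q \<in> X"
  shows "rank X f p < rank X f q \<longleftrightarrow> f p < f q"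
proof -
  have mono: "rank X f a \<le> rank X f b" if "f a \<le> f b" for a b
    unfolding rank_def using assms(1) that by (intro card_mono) auto
  have "rank X f p < rank X f q" if "f p < f q"
    unfolding rank_def
  proof (rule psubset_card_mono)
    have "q \<notin> {r \<in> X. f r \<le> f p}" "q \<in> {r \<in> X. f r \<le> f q}" using assms that by auto
    then show "{r \<in> X. f r \<le> f p} \<subset> {r \<in> X. f r \<le> f q}" using that by fastforce
  qed (use assms in auto)
  then show ?thesis using mono[of q p] by (metis not_le)
qed

lemma rank_bij:
  assumes "finite X" "inj_on f X"
  shows "bij_betw (rank X f) X {1..card X}"
proof -
  have inj: "inj_on (rank X f) X"
  proof (rule inj_onI)
    fix p q assume "p \<in> X" "q \<in> X" "rank X f p = rank X f q"
    then have "f p = f q"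
      using rank_less_iff[OF assms(1), of p q f] rank_less_iff[OF assms(1), of q p f] by force
    then show "p = q" using assms(2) \<open>p \<in> X\<close> \<open>q \<in> X\<close> by (auto dest: inj_onD)
  qed
  have "rank X f p \<in> {1..card X}" if "p \<in> X" for p
  proof -
    have "card {p} \<le> rank X f p" unfolding rank_def using assms that by (intro card_mono) auto
    moreover have "rank X f p \<le> card X" unfolding rank_def using assms by (intro card_mono) auto
    ultimately show ?thesis by simp
  qed
  then have "rank X f ` X \<subseteq> {1..card X}" by blast
  moreover have "card (rank X f ` X) = card {1..card X}" using inj by (simp add: card_image)
  ultimately have "rank X f ` X = {1..card X}" by (intro card_subset_eq) auto
  then show ?thesis using inj by (simp add: bij_betw_def)
qed

lemma rank_cong:
  assumes "\<And>q. q \<in> X \<Longrightarrow> f p < f q \<longleftrightarrow> g p < g q"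
  shows "rank X f p = rank X g p"
proof -
  have "{q \<in> X. f q \<le> f p} = {q \<in> X. g q \<le> g p}" using assms by (auto simp: not_less[symmetric])
  then show ?thesis by (simp add: rank_def)
qed

lemma rank_permutes:
  assumes "\<pi> permutes {1..n}" "p \<in> {1..n}"
  shows "rank {1..n} \<pi> p = \<pi> p"
proof -
  have "\<pi> ` {q \<in> {1..n}. \<pi> q \<le> \<pi> p} = {1..\<pi> p}"
  proof (intro equalityI subsetI)
    fix v assume "v \<in> {1..\<pi> p}"
    moreover have "\<pi> p \<le> n" using permutes_in_image[OF assms(1)] assms(2) by auto
    ultimately have "v \<in> \<pi> ` {1..n}" using permutes_image[OF assms(1)] by auto
    then show "v \<in> \<pi> ` {q \<in> {1..n}. \<pi> q \<le> \<pi> p}" using \<open>v \<in> {1..\<pi> p}\<close> by auto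
  qed (use permutes_in_image[OF assms(1)] in auto)
  moreover have "inj_on \<pi> {q \<in> {1..n}. \<pi> q \<le> \<pi> p}"
    using permutes_inj[OF assms(1)] by (rule inj_on_subset) simp
  ultimately show ?thesis unfolding rank_def using card_image by fastforce
qed

lemma rank_id: "p \<in> {1..n} \<Longrightarrow> rank {1..n} (\<lambda>x. x) p = p"
  using rank_permutes[OF permutes_id, of p n] by (simp add: id_def)

text \<open>A permutation of \<open>{1..k}\<close> is its own rank function, so relative order
  determines its values.\<close>

lemma permutes_eqI_order:
  fixes k :: nat
  assumes "\<sigma> permutes {1..k}" "\<tau> permutes {1..k}"
    and "\<And>i j. i \<in> {1..k} \<Longrightarrow> j \<in> {1..k} \<Longrightarrow> i \<noteq> j \<Longrightarrow> \<sigma> i < \<sigma> j \<longleftrightarrow> \<tau> i < \<tau> j"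
  shows "\<sigma> = \<tau>"
proof
  fix i show "\<sigma> i = \<tau> i"
  proof (cases "i \<in> {1..k}")
    case True
    have "rank {1..k} \<sigma> i = rank {1..k} \<tau> i" 
    proof (rule rank_cong)
      fix q assume "q \<in> {1..k}"
      then show "\<sigma> i < \<sigma> q \<longleftrightarrow> \<tau> i < \<tau> q" using assms(3)[of i q] True by (cases "i = q") auto
    qed
    then show ?thesis using True rank_permutes assms by simp
  qed (use assms(1,2) in \<open>auto simp: permutes_def\<close>)
qed

text \<open>A finite set with two linear orders, given by injections \<open>x\<close> and \<open>y\<close>, is a permutation up to
  isomorphism.\<close>

definition pattern :: "'a set \<Rightarrow> ('a \<Rightarrow> nat) \<Rightarrow> ('a \<Rightarrow> nat) \<Rightarrow> nat \<Rightarrow> nat"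
  where "pattern X x y r = (if r \<in> {1..card X} then rank X y (inv_into X (rank X x) r) else r)"

lemma pattern_rank:
  assumes "finite X" "inj_on x X" "p \<in> X"
  shows "pattern X x y (rank X x p) = rank X y p"
  using rank_bij[OF assms(1,2)] assms(3) bij_betwE[OF rank_bij[OF assms(1,2)]]
  by (auto simp: pattern_def bij_betw_def inv_into_f_f)

lemma pattern_permutes:
  assumes "finite X" "inj_on x X" "inj_on y X"
  shows "pattern X x y permutes {1..card X}"
proof (rule bij_imp_permutes)
  have "bij_betw (rank X y \<circ> inv_into X (rank X x)) {1..card X} {1..card X}"
    using bij_betw_inv_into[OF rank_bij[OF assms(1,2)]] rank_bij[OF assms(1,3)] by (rule bij_betw_trans)
  then show "bij_betw (pattern X x y) {1..card X} {1..card X}"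
    by (rule bij_betw_cong[THEN iffD1, rotated]) (simp add: pattern_def)
qed (auto simp: pattern_def)

lemma pattern_less_iff:
  assumes "finite X" "inj_on x X" "p \<in> X" "q \<in> X"
  shows "pattern X x y (rank X x p) < pattern X x y (rank X x q) \<longleftrightarrow> y p < y q"
  using assms by (simp add: pattern_rank rank_less_iff)

lemma pattern_eqI:
  assumes "finite X" "inj_on x X" "inj_on y X" "\<alpha> permutes {1..card X}"
    and "\<And>p q. p \<in> X \<Longrightarrow> q \<in> X \<Longrightarrow> \<alpha> (rank X x p) < \<alpha> (rank X x q) \<longleftrightarrow> y p < y q"
  shows "pattern X x y = \<alpha>"
proof (rule permutes_eqI_order[OF pattern_permutes[OF assms(1-3)] assms(4)])
  fix i j assume "i \<in> {1..card X}" "j \<in> {1..card X}"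
  then obtain p q where "p \<in> X" "q \<in> X" "i = rank X x p" "j = rank X x q"
    using rank_bij[OF assms(1,2)] by (metis bij_betw_imp_surj_on imageE)
  then show "pattern X x y i < pattern X x y j \<longleftrightarrow> \<alpha> i < \<alpha> j" using assms by (simp add: pattern_less_iff)
qed

section \<open>Descents as consecutive pairs, and their additivity\<close>

definition descents :: "'a set \<Rightarrow> ('a \<Rightarrow> nat) \<Rightarrow> ('a \<Rightarrow> nat) \<Rightarrow> ('a \<times> 'a) set"
  where "descents X x y = {(p, q). p \<in> X \<and> q \<in> X \<and> x p < x q \<and>
    (\<forall>z\<in>X. \<not> (x p < x z \<and> x z < x q)) \<and> y q < y p}"

definition des_wrt :: "'a set \<Rightarrow> ('a \<Rightarrow> nat) \<Rightarrow> ('a \<Rightarrow> nat) \<Rightarrow> nat"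
  where "des_wrt X x y = card (descents X x y)"

lemma des_wrt_cong:
  assumes "\<And>p q. p \<in> X \<Longrightarrow> q \<in> X \<Longrightarrow> x p < x q \<longleftrightarrow> x' p < x' q"
    and "\<And>p q. p \<in> X \<Longrightarrow> q \<in> X \<Longrightarrow> y p < y q \<longleftrightarrow> y' p < y' q"
  shows "des_wrt X x y = des_wrt X x' y'"
  unfolding des_wrt_def descents_def by (rule arg_cong[where f = card]) (use assms in auto)

lemma des_wrt_image:
  assumes "inj_on g X"
  shows "des_wrt (g ` X) x y = des_wrt X (x \<circ> g) (y \<circ> g)"
proof -
  let ?S = "{(p, q). p \<in> X \<and> q \<in> X \<and> x (g p) < x (g q) \<and>
    (\<forall>z\<in>X. \<not> (x (g p) < x (g z) \<and> x (g z) < x (g q))) \<and> y (g q) < y (g p)}"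
  have "{(p, q). p \<in> g ` X \<and> q \<in> g ` X \<and> x p < x q \<and>
    (\<forall>z\<in>g ` X. \<not> (x p < x z \<and> x z < x q)) \<and> y q < y p} = map_prod g g ` ?S" by (auto simp: image_iff) 
  moreover have "inj_on (map_prod g g) ?S"
    by (rule inj_on_subset[OF map_prod_inj_on[OF assms assms]]) auto
  ultimately show ?thesis unfolding des_wrt_def descents_def by (simp add: card_image)
qed

lemma des_eq_des_wrt: "des n \<pi> = des_wrt {1..n} (\<lambda>p. p) \<pi>"
proof -
  have "{(p, q). p \<in> {1..n} \<and> q \<in> {1..n} \<and> p < q \<and> (\<forall>z\<in>{1..n}. \<not> (p < z \<and> z < q)) \<and> \<pi> q < \<pi> p}
    = (\<lambda>i. (i, i + 1)) ` {i \<in> {1..n - 1}. \<pi> i > \<pi> (i + 1)}" (is "?L = ?R")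
  proof (intro equalityI subsetI)
    fix a assume "a \<in> ?L"
    then obtain p q where a: "a = (p, q)" "p \<in> {1..n}" "q \<in> {1..n}" "p < q"
      "\<forall>z\<in>{1..n}. \<not> (p < z \<and> z < q)" "\<pi> q < \<pi> p" by auto
    have "q = p + 1" using a(2-5) by (auto dest!: bspec[of _ _ "p + 1"])
    then show "a \<in> ?R" using a by auto
  qed auto
  then show ?thesis unfolding des_def des_wrt_def descents_def by (simp add: card_image inj_on_def)
qed

text \<open>Reindexing along \<open>\<pi>\<close> makes the values the new positions, so inversion
  exchanges the two orders.\<close>

lemma ides_eq_des_wrt:
  assumes "\<pi> permutes {1..n}"
  shows "ides n \<pi> = des_wrt {1..n} \<pi> (\<lambda>p. p)"
proof -
  have "ides n \<pi> = des_wrt (\<pi> ` {1..n}) (\<lambda>p. p) (inv \<pi>)"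
    unfolding permutes_image[OF assms] by (simp add: ides_def des_eq_des_wrt)
  also have "\<dots> = des_wrt {1..n} \<pi> (\<lambda>p. p)"
    using permutes_inverses(2)[OF assms] permutes_inj_on[OF assms]
    by (subst des_wrt_image) (simp_all add: comp_def)
  finally show ?thesis .
qed

lemma des_ides_pattern:
  assumes "finite X" "inj_on x X" "inj_on y X"
  shows "des (card X) (pattern X x y) = des_wrt X x y" "ides (card X) (pattern X x y) = des_wrt X y x"
proof -
  have im: "rank X x ` X = {1..card X}" and inj: "inj_on (rank X x) X"
    using rank_bij[OF assms(1,2)] by (auto simp: bij_betw_def)
  show "des (card X) (pattern X x y) = des_wrt X x y"
    unfolding des_eq_des_wrt im[symmetric] des_wrt_image[OF inj]
    by (rule des_wrt_cong) (use assms in \<open>simp_all add: pattern_less_iff rank_less_iff\<close>)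
  show "ides (card X) (pattern X x y) = des_wrt X y x"
    unfolding ides_eq_des_wrt[OF pattern_permutes[OF assms]] im[symmetric] des_wrt_image[OF inj]
    by (rule des_wrt_cong) (use assms in \<open>simp_all add: pattern_less_iff rank_less_iff\<close>)
qed

text \<open>Both orders compare different fibers through \<open>B\<close> alone, so every fiber is
  an interval. A consecutive pair either stays in one fiber or passes from a fiber to the next one,
  and each consecutive pair of \<open>B\<close> is crossed exactly once because no fiber over
  \<open>B\<close> is empty.\<close>

lemma des_wrt_lex:
  assumes fin: "finite X" and surj: "b ` X = B" and injx: "inj_on x X"
    and x: "\<And>p q. p \<in> X \<Longrightarrow> q \<in> X \<Longrightarrow> b p \<noteq> b q \<Longrightarrow> x p < x q \<longleftrightarrow> u (b p) < u (b q)"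
    and y: "\<And>p q. p \<in> X \<Longrightarrow> q \<in> X \<Longrightarrow> b p \<noteq> b q \<Longrightarrow> y p < y q \<longleftrightarrow> v (b p) < v (b q)"
  shows "des_wrt X x y = des_wrt B u v + (\<Sum>i\<in>B. des_wrt {p \<in> X. b p = i} x y)"
proof -
  let ?fiber = "\<lambda>i. {p \<in> X. b p = i}"
  \<comment> \<open>The descents that cross from one fiber to another.\<close>
  let ?E = "{(p, q) \<in> descents X x y. b p \<noteq> b q}"
  have finB: "finite B" using fin surj by auto
  have finD: "finite (descents Z x y)" if "Z \<subseteq> X" for Z
    by (rule finite_subset[of _ "X \<times> X"]) (use that fin in \<open>auto simp: descents_def\<close>)
  have split: "descents X x y = ?E \<union> (\<Union>i\<in>B. descents (?fiber i) x y)"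
  proof (intro equalityI subsetI)
    fix a assume a: "a \<in> descents X x y"
    then show "a \<in> ?E \<union> (\<Union>i\<in>B. descents (?fiber i) x y)" using surj by (auto simp: descents_def)
  next
    fix a assume "a \<in> ?E \<union> (\<Union>i\<in>B. descents (?fiber i) x y)"
    then consider "a \<in> ?E" | i where "i \<in> B" "a \<in> descents (?fiber i) x y" by blast
    then show "a \<in> descents X x y"
    proof cases
      case 2
      then obtain p q where pq: "a = (p, q)" "p \<in> X" "q \<in> X" "b p = i" "b q = i" "x p < x q" "y q < y p"
        and no: "\<And>z. z \<in> X \<Longrightarrow> b z = i \<Longrightarrow> \<not> (x p < x z \<and> x z < x q)" by (auto simp: descents_def)
      \<comment> \<open>An element of another fiber compares alike with \<open>p\<close> and
        \<open>q\<close>, so it cannot separate them.\<close>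
      have "\<not> (x p < x z \<and> x z < x q)" if "z \<in> X" for z
      proof (cases "b z = i")
        case False
        then show ?thesis using x[of p z] x[of z q] that pq by auto
      qed (use no that in auto)
      then show ?thesis using pq by (auto simp: descents_def)
    qed auto
  qed
  have "card (descents X x y) = card (?E \<union> (\<Union>i\<in>B. descents (?fiber i) x y))"
    using split by (rule arg_cong)
  also have "\<dots> = card ?E + card (\<Union>i\<in>B. descents (?fiber i) x y)"
  proof (rule card_Un_disjoint)
    show "finite ?E" by (rule finite_subset[OF _ finD[OF subset_refl]]) auto
    show "finite (\<Union>i\<in>B. descents (?fiber i) x y)" using finB finD by auto
    show "?E \<inter> (\<Union>i\<in>B. descents (?fiber i) x y) = {}" by (auto simp: descents_def)
  qed
  also have "card (\<Union>i\<in>B. descents (?fiber i) x y) = (\<Sum>i\<in>B. card (descents (?fiber i) x y))"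
    using finB by (intro card_UN_disjoint ballI impI finD) (auto simp: descents_def)
  also have "card ?E = card (descents B u v)"
  proof (rule bij_betw_same_card)
    show "bij_betw (map_prod b b) ?E (descents B u v)"
      unfolding bij_betw_def
    proof (intro conjI inj_onI equalityI subsetI)
      fix a a' assume "a \<in> ?E" "a' \<in> ?E" "map_prod b b a = map_prod b b a'"
      then obtain p q p' q' where a: "a = (p, q)" "a' = (p', q')" "b p = b p'" "b q = b q'" "b p \<noteq> b q"
        "p \<in> X" "q \<in> X" "p' \<in> X" "q' \<in> X" "x p < x q" "x p' < x q'"
        and no: "\<And>z. z \<in> X \<Longrightarrow> \<not> (x p < x z \<and> x z < x q)" "\<And>z. z \<in> X \<Longrightarrow> \<not> (x p' < x z \<and> x z < x q')"
        by (auto simp: descents_def)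
      \<comment> \<open>Both lower ends precede both upper ends, so if the pairs differed, an end of
        one would lie strictly inside the other.\<close>
      have "x p < x q'" "x p' < x q"
        using x[of p q] x[of p' q'] x[of p q'] x[of p' q] a by auto
      then have "x p = x p'" "x q = x q'"
        using no(1)[of p'] no(2)[of p] no(1)[of q'] no(2)[of q] a by linarith+
      then show "a = a'" using a injx by (auto dest: inj_onD)
    next
      fix a assume "a \<in> map_prod b b ` ?E"
      then obtain p q where a: "a = (b p, b q)" "p \<in> X" "q \<in> X" "b p \<noteq> b q" "x p < x q" "y q < y p"
        and no: "\<And>z. z \<in> X \<Longrightarrow> \<not> (x p < x z \<and> x z < x q)"
        by (auto simp: descents_def)
      have "\<not> (u (b p) < u (b z) \<and> u (b z) < u (b q))" if "z \<in> X" for z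
        using x[of p z] x[of z q] no[OF that] a that by (cases "b p = b z"; cases "b z = b q") auto
      moreover have "u (b p) < u (b q)" "v (b q) < v (b p)" using x[of p q] y[of q p] a by auto
      ultimately show "a \<in> descents B u v" using a surj by (auto simp: descents_def)
    next
      fix a assume "a \<in> descents B u v"
      then obtain i j where a: "a = (i, j)" "i \<in> B" "j \<in> B" "u i < u j" "v j < v i"
        and no: "\<And>l. l \<in> B \<Longrightarrow> \<not> (u i < u l \<and> u l < u j)" by (auto simp: descents_def)
      have ne: "?fiber i \<noteq> {}" "?fiber j \<noteq> {}" using a surj by auto
      \<comment> \<open>The crossing pair joins the last element of fiber \<open>i\<close> to the
        first element of fiber \<open>j\<close>.\<close>
      have "Max (x ` ?fiber i) \<in> x ` ?fiber i" "Min (x ` ?fiber j) \<in> x ` ?fiber j"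
        using ne fin by (auto intro!: Max_in Min_in simp del: Max_in Min_in)
      then obtain p q where p: "p \<in> X" "b p = i" "x p = Max (x ` ?fiber i)"
        and q: "q \<in> X" "b q = j" "x q = Min (x ` ?fiber j)" by force
      have pm: "\<not> x p < x z" if "z \<in> X" "b z = i" for z
        using that fin unfolding p(3) by (auto simp: not_less intro!: Max_ge)
      have qm: "\<not> x z < x q" if "z \<in> X" "b z = j" for z
        using that fin unfolding q(3) by (auto simp: not_less intro!: Min_le)
      have "i \<noteq> j" using a by auto
      have "\<not> (x p < x z \<and> x z < x q)" if "z \<in> X" for z
      proof
        assume z: "x p < x z \<and> x z < x q"
        then have "b z \<noteq> i" "b z \<noteq> j" using pm qm that by auto
        then show False using x[of p z] x[of z q] no[of "b z"] p q z that surj by auto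
      qed
      moreover have "x p < x q" "y q < y p" using x[of p q] y[of q p] p q a \<open>i \<noteq> j\<close> by auto
      ultimately have "(p, q) \<in> ?E" using p q \<open>i \<noteq> j\<close> by (auto simp: descents_def)
      then show "a \<in> map_prod b b ` ?E" using a p q by force
    qed
  qed
  finally show ?thesis by (simp add: des_wrt_def)
qed

section \<open>Inflations\<close>

definition Perm :: "nat \<Rightarrow> (nat \<Rightarrow> nat) set"
  where "Perm n = {\<pi>. \<pi> permutes {1..n}}"

definition weight :: "nat \<Rightarrow> (nat \<Rightarrow> nat) \<Rightarrow> real poly poly"
  where "weight n \<pi> = var_s ^ des n \<pi> * var_t ^ ides n \<pi>"

text \<open>The sequence of blocks of an inflation is encoded by the map \<open>b\<close> sending each position to the
  index of its block, so that compositions of \<open>n\<close> become monotone surjections.\<close>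

definition mono_surj :: "nat \<Rightarrow> nat \<Rightarrow> (nat \<Rightarrow> nat) set"
  where "mono_surj n k =
    {b \<in> {1..n} \<rightarrow>\<^sub>E {1..k}. mono_on {1..n} b \<and> b ` {1..n} = {1..k}}"

definition fiber :: "nat \<Rightarrow> (nat \<Rightarrow> nat) \<Rightarrow> nat \<Rightarrow> nat set"
  where "fiber n b i = {p \<in> {1..n}. b p = i}"

text \<open>Only comparisons across blocks are prescribed; the order inside each block stays
  free.\<close>

definition inflations :: "nat \<Rightarrow> (nat \<Rightarrow> nat) \<Rightarrow> (nat \<Rightarrow> nat) \<Rightarrow> (nat \<Rightarrow> nat) set"
  where "inflations n b \<sigma> = {\<pi> \<in> Perm n. \<forall>p\<in>{1..n}. \<forall>q\<in>{1..n}.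
    b p \<noteq> b q \<longrightarrow> \<pi> p < \<pi> q \<longleftrightarrow> \<sigma> (b p) < \<sigma> (b q)}"

definition component :: "nat \<Rightarrow> (nat \<Rightarrow> nat) \<Rightarrow> (nat \<Rightarrow> nat) \<Rightarrow> nat \<Rightarrow> nat \<Rightarrow> nat"
  where "component n b \<pi> i = pattern (fiber n b i) (\<lambda>p. p) \<pi>"

lemma finite_Perm [simp]: "finite (Perm n)"
  by (simp add: Perm_def finite_permutations)

lemma finite_fiber [simp]: "finite (fiber n b i)"
  by (simp add: fiber_def)

lemma finite_inflations [simp]: "finite (inflations n b \<sigma>)"
  by (simp add: inflations_def)

lemma finite_mono_surj [simp]: "finite (mono_surj n k)"
  by (rule finite_subset[of _ "{1..n} \<rightarrow>\<^sub>E {1..k}"]) (auto simp: mono_surj_def intro: finite_PiE)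

lemma Perm_inj: "\<pi> \<in> Perm n \<Longrightarrow> inj_on \<pi> A"
  by (auto simp: Perm_def intro: inj_on_subset[OF permutes_inj])

lemma mono_surj_less_iff:
  assumes "b \<in> mono_surj n k" "p \<in> {1..n}" "q \<in> {1..n}" "b p \<noteq> b q"
  shows "p < q \<longleftrightarrow> b p < b q"
proof -
  have mono: "b x \<le> b y" if "x \<in> {1..n}" "y \<in> {1..n}" "x \<le> y" for x y
    using assms(1) that by (auto simp: mono_surj_def monotone_on_def)
  show ?thesis using mono[of p q] mono[of q p] assms(2-4) by (metis le_neq_implies_less not_le order_less_imp_le)
qed

lemma component_Perm: "\<pi> \<in> Perm n \<Longrightarrow> component n b \<pi> i \<in> Perm (card (fiber n b i))"
  unfolding component_def Perm_def mem_Collect_eq by (rule pattern_permutes) (auto intro: permutes_inj_on)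

text \<open>\<open>des_wrt_lex\<close> is applied twice, the second time with positions and values
  exchanged.\<close>

lemma weight_inflations:
  assumes b: "b \<in> mono_surj n k" and \<sigma>: "\<sigma> \<in> Perm k" and \<pi>: "\<pi> \<in> inflations n b \<sigma>"
  shows "weight n \<pi> = weight k \<sigma> * (\<Prod>i\<in>{1..k}. weight (card (fiber n b i)) (component n b \<pi> i))"
proof -
  have P: "\<pi> \<in> Perm n" using \<pi> by (simp add: inflations_def)
  have im: "b ` {1..n} = {1..k}" using b by (simp add: mono_surj_def)
  have less: "\<pi> p < \<pi> q \<longleftrightarrow> \<sigma> (b p) < \<sigma> (b q)" if "p \<in> {1..n}" "q \<in> {1..n}" "b p \<noteq> b q" for p q
    using \<pi> that by (auto simp: inflations_def)
  have "des n \<pi> = des k \<sigma> + (\<Sum>i\<in>{1..k}. des_wrt (fiber n b i) (\<lambda>p. p) \<pi>)"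
    unfolding des_eq_des_wrt fiber_def by (rule des_wrt_lex) (use im less mono_surj_less_iff[OF b] in auto)
  moreover have "ides n \<pi> = ides k \<sigma> + (\<Sum>i\<in>{1..k}. des_wrt (fiber n b i) \<pi> (\<lambda>p. p))"
    unfolding ides_eq_des_wrt[OF P[unfolded Perm_def mem_Collect_eq]]
      ides_eq_des_wrt[OF \<sigma>[unfolded Perm_def mem_Collect_eq]] fiber_def
    by (rule des_wrt_lex) (use im less mono_surj_less_iff[OF b] Perm_inj[OF P] in auto)
  moreover have "des (card (fiber n b i)) (component n b \<pi> i) = des_wrt (fiber n b i) (\<lambda>p. p) \<pi>"
    "ides (card (fiber n b i)) (component n b \<pi> i) = des_wrt (fiber n b i) \<pi> (\<lambda>p. p)" for i
    unfolding component_def by (simp_all add: des_ides_pattern Perm_inj[OF P])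
  ultimately show ?thesis
    by (simp add: weight_def power_add power_sum prod.distrib mult_ac)
qed

text \<open>Comparisons across blocks come from \<open>\<sigma>\<close> and those inside a block
  from its component, so nothing else is left to choose. Conversely, any choice of components is
  realized by ordering positions lexicographically and standardizing.\<close>

lemma inflations_bij:
  assumes b: "b \<in> mono_surj n k" and \<sigma>: "\<sigma> \<in> Perm k"
  shows "bij_betw (\<lambda>\<pi>. \<lambda>i\<in>{1..k}. component n b \<pi> i) (inflations n b \<sigma>)
    (PiE {1..k} (\<lambda>i. Perm (card (fiber n b i))))"
  unfolding bij_betw_def
proof (intro conjI inj_onI equalityI subsetI)
  have im: "b ` {1..n} = {1..k}" using b by (simp add: mono_surj_def)
  fix \<pi> \<tau> assume \<pi>\<tau>: "\<pi> \<in> inflations n b \<sigma>" "\<tau> \<in> inflations n b \<sigma>"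
    "(\<lambda>i\<in>{1..k}. component n b \<pi> i) = (\<lambda>i\<in>{1..k}. component n b \<tau> i)"
  have P: "\<pi> permutes {1..n}" "\<tau> permutes {1..n}" using \<pi>\<tau> by (auto simp: inflations_def Perm_def)
  show "\<pi> = \<tau>"
  proof (rule permutes_eqI_order[OF P])
    fix p q assume pq: "p \<in> {1..n}" "q \<in> {1..n}" "p \<noteq> q"
    show "\<pi> p < \<pi> q \<longleftrightarrow> \<tau> p < \<tau> q"
    proof (cases "b p = b q")
      case True
      define i where "i = b p"
      have "i \<in> {1..k}" using im pq(1) unfolding i_def by blast
      then have c: "component n b \<pi> i = component n b \<tau> i" using fun_cong[OF \<pi>\<tau>(3), of i] by simp
      have mem: "p \<in> fiber n b i" "q \<in> fiber n b i" using pq True by (auto simp: fiber_def i_def)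
      show ?thesis
        using pattern_less_iff[of "fiber n b i" "\<lambda>p. p", OF _ _ mem, of \<pi>]
          pattern_less_iff[of "fiber n b i" "\<lambda>p. p", OF _ _ mem, of \<tau>] c unfolding component_def by simp
    qed (use \<pi>\<tau>(1,2) pq in \<open>auto simp: inflations_def\<close>)
  qed
next
  fix \<alpha> assume "\<alpha> \<in> (\<lambda>\<pi>. \<lambda>i\<in>{1..k}. component n b \<pi> i) ` inflations n b \<sigma>"
  then obtain \<pi> where "\<pi> \<in> Perm n" "\<alpha> = (\<lambda>i\<in>{1..k}. component n b \<pi> i)" unfolding inflations_def by blast
  then show "\<alpha> \<in> PiE {1..k} (\<lambda>i. Perm (card (fiber n b i)))"
    by (auto simp: component_Perm)
next
  have im: "b ` {1..n} = {1..k}" using b by (simp add: mono_surj_def)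
  fix \<alpha> assume \<alpha>: "\<alpha> \<in> PiE {1..k} (\<lambda>i. Perm (card (fiber n b i)))"
  define off where "off p = rank (fiber n b (b p)) (\<lambda>p. p) p" for p
  \<comment> \<open>Encodes the lexicographic order on pairs; the base \<open>Suc n\<close> exceeds
    every value of a component.\<close>
  define f where "f p = \<sigma> (b p) * Suc n + \<alpha> (b p) (off p)" for p
  define \<pi> where "\<pi> = pattern {1..n} (\<lambda>p. p) f"
  have bk: "b p \<in> {1..k}" if "p \<in> {1..n}" for p using im that by blast
  have \<alpha>P: "\<alpha> i \<in> Perm (card (fiber n b i))" if "i \<in> {1..k}" for i
    using \<alpha> that by (rule PiE_mem)
  have small: "\<alpha> (b p) (off p) < Suc n" if p: "p \<in> {1..n}" for p
  proof -
    have "off p \<in> {1..card (fiber n b (b p))}"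
      unfolding off_def by (rule bij_betw_apply[OF rank_bij]) (use p in \<open>auto simp: fiber_def\<close>)
    moreover have "\<alpha> (b p) permutes {1..card (fiber n b (b p))}"
      using \<alpha>P[OF bk[OF p]] by (simp only: Perm_def mem_Collect_eq)
    ultimately have "\<alpha> (b p) (off p) \<in> {1..card (fiber n b (b p))}"
      using permutes_in_image by metis
    moreover have "card (fiber n b (b p)) \<le> card {1..n}" by (intro card_mono) (auto simp: fiber_def)
    ultimately show ?thesis by simp
  qed
  have lex: "a * Suc n + c < a' * Suc n + c'" if "a < a'" "c < Suc n" for a a' c c' :: nat
  proof -
    have "a * Suc n + c < Suc a * Suc n" using that by simp
    also have "\<dots> \<le> a' * Suc n" using that by (intro mult_le_mono) auto
    finally show ?thesis by simp
  qed
  have f_diff: "f p < f q \<longleftrightarrow> \<sigma> (b p) < \<sigma> (b q)" if "p \<in> {1..n}" "q \<in> {1..n}" "b p \<noteq> b q" for p q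
  proof -
    have "\<sigma> (b p) \<noteq> \<sigma> (b q)" using Perm_inj[OF \<sigma>, of UNIV] that(3) by (auto dest: injD)
    then show ?thesis
      using lex[of "\<sigma> (b p)" "\<sigma> (b q)", OF _ small[OF that(1)]]
        lex[of "\<sigma> (b q)" "\<sigma> (b p)", OF _ small[OF that(2)]]
      unfolding f_def by (metis less_asym nat_neq_iff)
  qed
  have inj: "inj_on f {1..n}"
  proof (rule inj_onI)
    fix p q assume pq: "p \<in> {1..n}" "q \<in> {1..n}" "f p = f q"
    have \<sigma>eq: "b p = b q"
      using f_diff[of p q] f_diff[of q p] pq Perm_inj[OF \<sigma>, of UNIV] by (metis injD less_irrefl nat_neq_iff)
    then have "off p = off q"
      using pq(3) Perm_inj[OF \<alpha>P[OF bk[OF pq(1)]], of UNIV] by (auto simp: f_def dest: injD)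
    moreover have "inj_on (rank (fiber n b (b p)) (\<lambda>p. p)) (fiber n b (b p))"
      using rank_bij[of "fiber n b (b p)" "\<lambda>p. p"] by (simp add: bij_betw_def)
    ultimately show "p = q" using \<sigma>eq pq(1,2) by (auto simp: off_def fiber_def dest: inj_onD)
  qed
  have \<pi>P: "\<pi> \<in> Perm n" unfolding \<pi>_def Perm_def using pattern_permutes[of "{1..n}" "\<lambda>p. p" f] inj by simp
  have \<pi>_less: "\<pi> p < \<pi> q \<longleftrightarrow> f p < f q" if "p \<in> {1..n}" "q \<in> {1..n}" for p q
    using pattern_less_iff[of "{1..n}" "\<lambda>p. p" p q f] that
    unfolding \<pi>_def rank_id[OF that(1)] rank_id[OF that(2)] by simp
  have inflations: "\<pi> \<in> inflations n b \<sigma>" unfolding inflations_def using \<pi>P f_diff \<pi>_less by auto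
  have "component n b \<pi> i = \<alpha> i" if i: "i \<in> {1..k}" for i
    unfolding component_def
  proof (rule pattern_eqI)
    show "\<alpha> i permutes {1..card (fiber n b i)}" using \<alpha>P[OF i] by (simp add: Perm_def)
    fix p q assume "p \<in> fiber n b i" "q \<in> fiber n b i"
    then show "\<alpha> i (rank (fiber n b i) (\<lambda>p. p) p) < \<alpha> i (rank (fiber n b i) (\<lambda>p. p) q) \<longleftrightarrow> \<pi> p < \<pi> q"
      using \<pi>_less[of p q] by (auto simp: fiber_def f_def off_def)
  qed (auto simp: Perm_inj[OF \<pi>P])
  then have "\<alpha> = (\<lambda>i\<in>{1..k}. component n b \<pi> i)" using \<alpha> by (intro ext) (auto simp: PiE_def extensional_def)
  then show "\<alpha> \<in> (\<lambda>\<pi>. \<lambda>i\<in>{1..k}. component n b \<pi> i) ` inflations n b \<sigma>" using inflations by blast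
qed

text \<open>The sets \<open>T i\<close> allow restrictions on single components: direct and skew
  sums need an indecomposable first one.\<close>

lemma sum_weight_inflations:
  assumes b: "b \<in> mono_surj n k" and \<sigma>: "\<sigma> \<in> Perm k"
    and T: "\<And>i. i \<in> {1..k} \<Longrightarrow> T i \<subseteq> Perm (card (fiber n b i))"
  shows "(\<Sum>\<pi> | \<pi> \<in> inflations n b \<sigma> \<and> (\<forall>i\<in>{1..k}. component n b \<pi> i \<in> T i). weight n \<pi>) =
    weight k \<sigma> * (\<Prod>i\<in>{1..k}. \<Sum>\<alpha>\<in>T i. weight (card (fiber n b i)) \<alpha>)"
proof -
  let ?h = "\<lambda>\<pi>. \<lambda>i\<in>{1..k}. component n b \<pi> i"
  let ?S = "{\<pi> \<in> inflations n b \<sigma>. \<forall>i\<in>{1..k}. component n b \<pi> i \<in> T i}"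
  have inj: "inj_on ?h (inflations n b \<sigma>)" and im: "?h ` inflations n b \<sigma> = PiE {1..k} (\<lambda>i. Perm (card (fiber n b i)))"
    using inflations_bij[OF b \<sigma>] by (simp_all only: bij_betw_def)
  have sub: "PiE {1..k} T \<subseteq> PiE {1..k} (\<lambda>i. Perm (card (fiber n b i)))"
    by (rule PiE_mono) (rule T)
  have "?h ` ?S = PiE {1..k} T"
  proof (intro equalityI subsetI)
    fix \<alpha> assume \<alpha>: "\<alpha> \<in> PiE {1..k} T"
    then have "\<alpha> \<in> ?h ` inflations n b \<sigma>" unfolding im using sub by (rule subsetD[rotated])
    then obtain \<pi> where \<pi>: "\<pi> \<in> inflations n b \<sigma>" "\<alpha> = ?h \<pi>" by blast
    have "component n b \<pi> i \<in> T i" if "i \<in> {1..k}" for i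
      using PiE_mem[OF \<alpha> that] that unfolding \<pi>(2) by simp
    then show "\<alpha> \<in> ?h ` ?S" using \<pi> by blast
  qed auto
  moreover have "inj_on ?h ?S" by (rule inj_on_subset[OF inj]) auto
  ultimately have bij: "bij_betw ?h ?S (PiE {1..k} T)" by (simp add: bij_betw_def)
  have "(\<Sum>\<pi>\<in>?S. weight n \<pi>) = (\<Sum>\<pi>\<in>?S. weight k \<sigma> * (\<Prod>i\<in>{1..k}. weight (card (fiber n b i)) (?h \<pi> i)))"
    by (intro sum.cong) (simp_all add: weight_inflations[OF b \<sigma>])
  also have "\<dots> = (\<Sum>\<alpha>\<in>PiE {1..k} T. weight k \<sigma> * (\<Prod>i\<in>{1..k}. weight (card (fiber n b i)) (\<alpha> i)))"
    by (rule sum.reindex_bij_betw[OF bij])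
  also have "\<dots> = weight k \<sigma> * (\<Prod>i\<in>{1..k}. \<Sum>\<alpha>\<in>T i. weight (card (fiber n b i)) \<alpha>)"
    using finite_subset[OF T finite_Perm] by (subst prod_sum_PiE) (simp_all add: sum_distrib_left)
  finally show ?thesis .
qed

section \<open>Direct and skew sums\<close>

text \<open>Cuts exhibiting \<open>\<pi>\<close> as a direct sum (\<open>\<epsilon> = True\<close>) or as a skew sum (\<open>\<epsilon> = False\<close>).\<close>

definition splits :: "bool \<Rightarrow> nat \<Rightarrow> nat \<Rightarrow> (nat \<Rightarrow> nat) \<Rightarrow> bool"
  where "splits \<epsilon> n j \<pi> \<longleftrightarrow> (\<forall>p\<in>{1..j}. \<forall>q\<in>{j<..n}. (\<pi> p < \<pi> q) = \<epsilon>)"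

definition decomp :: "bool \<Rightarrow> nat \<Rightarrow> (nat \<Rightarrow> nat) set"
  where "decomp \<epsilon> n = {\<pi> \<in> Perm n. \<exists>j\<in>{1..<n}. splits \<epsilon> n j \<pi>}"

text \<open>The permutations 12 and 21, whose inflations are the direct and the skew sums.\<close>

definition perm2 :: "bool \<Rightarrow> nat \<Rightarrow> nat"
  where "perm2 \<epsilon> = (if \<epsilon> then id else Transposition.transpose 1 2)"

definition cut :: "nat \<Rightarrow> nat \<Rightarrow> nat \<Rightarrow> nat"
  where "cut n j = (\<lambda>p\<in>{1..n}. if p \<le> j then 1 else 2)"

lemma perm2_Perm: "perm2 \<epsilon> \<in> Perm 2"
  unfolding Perm_def perm2_def using permutes_id permutes_swap_id[of 1 "{1..2::nat}" 2] by auto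

lemma perm2_values: "perm2 \<epsilon> 1 = (if \<epsilon> then 1 else 2)" "perm2 \<epsilon> 2 = (if \<epsilon> then 2 else 1)"
  by (simp_all add: perm2_def)

lemma weight_perm2: "weight 2 (perm2 \<epsilon>) = (if \<epsilon> then 1 else var_s * var_t)"
proof -
  have "inv (perm2 \<epsilon>) = perm2 \<epsilon>" unfolding perm2_def by (simp add: inv_swap_id)
  then have "ides 2 (perm2 \<epsilon>) = des 2 (perm2 \<epsilon>)" by (simp add: ides_def)
  moreover have "{i \<in> {1..2 - 1::nat}. perm2 \<epsilon> i > perm2 \<epsilon> (i + 1)} = (if \<epsilon> then {} else {1})"
  proof -
    have "{1..2 - 1::nat} = {1}" by auto
    moreover have "perm2 \<epsilon> (1 + 1) = perm2 \<epsilon> 2" by (simp add: numeral_2_eq_2)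
    ultimately show ?thesis using perm2_values[of \<epsilon>] by auto
  qed
  ultimately show ?thesis by (simp add: weight_def des_def)
qed

lemma cut_mono_surj:
  assumes "1 \<le> j" "j < n"
  shows "cut n j \<in> mono_surj n 2"
proof -
  have "{1..2::nat} = {1, 2}" by auto
  moreover have "cut n j ` {1..n} = {1, 2}"
  proof (intro equalityI subsetI)
    fix x assume "x \<in> {1, 2::nat}"
    then have "x = cut n j 1 \<or> x = cut n j n" using assms by (auto simp: cut_def)
    then show "x \<in> cut n j ` {1..n}" using assms by force
  qed (auto simp: cut_def)
  ultimately show ?thesis
    unfolding mono_surj_def by (auto simp: cut_def monotone_on_def)
qed

lemma fiber_cut:
  assumes "1 \<le> j" "j < n"
  shows "fiber n (cut n j) 1 = {1..j}" "fiber n (cut n j) 2 = {j<..n}"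
  using assms by (auto simp: fiber_def cut_def)

text \<open>Makes \<open>sum_weight_inflations\<close> available for sums with a fixed cut.\<close>

lemma inflations_cut:
  assumes "1 \<le> j" "j < n"
  shows "inflations n (cut n j) (perm2 \<epsilon>) = {\<pi> \<in> Perm n. splits \<epsilon> n j \<pi>}"
proof (intro equalityI subsetI)
  fix \<pi> assume \<pi>: "\<pi> \<in> inflations n (cut n j) (perm2 \<epsilon>)"
  have "(\<pi> p < \<pi> q) = \<epsilon>" if "p \<in> {1..j}" "q \<in> {j<..n}" for p q
  proof -
    have "p \<in> {1..n}" "q \<in> {1..n}" "cut n j p = 1" "cut n j q = 2" using that assms by (auto simp: cut_def)
    then show ?thesis using \<pi> perm2_values[of \<epsilon>] by (auto simp: inflations_def split: if_splits)
  qed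
  then show "\<pi> \<in> {\<pi> \<in> Perm n. splits \<epsilon> n j \<pi>}" using \<pi> by (auto simp: inflations_def splits_def)
next
  fix \<pi> assume \<pi>: "\<pi> \<in> {\<pi> \<in> Perm n. splits \<epsilon> n j \<pi>}"
  have "\<pi> p < \<pi> q \<longleftrightarrow> perm2 \<epsilon> (cut n j p) < perm2 \<epsilon> (cut n j q)"
    if pq: "p \<in> {1..n}" "q \<in> {1..n}" "cut n j p \<noteq> cut n j q" for p q
  proof (cases "p \<le> j")
    case True
    then have "\<not> q \<le> j" using pq by (auto simp: cut_def)
    then have "(\<pi> p < \<pi> q) = \<epsilon>" "cut n j p = 1" "cut n j q = 2"
      using True pq(1,2) \<pi> by (auto simp: splits_def cut_def)
    then show ?thesis using perm2_values[of \<epsilon>] by auto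
  next
    case False
    then have "q \<le> j" using pq by (auto simp: cut_def split: if_splits)
    then have "(\<pi> q < \<pi> p) = \<epsilon>" "cut n j p = 2" "cut n j q = 1"
      using False pq(1,2) \<pi> by (auto simp: splits_def cut_def)
    moreover have "\<pi> p \<noteq> \<pi> q" using False \<open>q \<le> j\<close> \<pi> Perm_inj[of \<pi> n UNIV] by (auto dest: injD)
    ultimately show ?thesis using perm2_values[of \<epsilon>] by (auto split: if_splits)
  qed
  then show "\<pi> \<in> inflations n (cut n j) (perm2 \<epsilon>)" using \<pi> by (auto simp: inflations_def)
qed

lemma decomp_subset: "decomp \<epsilon> n \<subseteq> Perm n"
  by (auto simp: decomp_def)

text \<open>A decomposable permutation is cut at the first admissible position, which makes the first
  component indecomposable.\<close>

lemma sum_weight_decomp: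
  "(\<Sum>\<pi>\<in>decomp \<epsilon> n. weight n \<pi>) = (\<Sum>j\<in>{1..<n}. weight 2 (perm2 \<epsilon>) *
     ((\<Sum>\<pi>\<in>Perm j - decomp \<epsilon> j. weight j \<pi>) * (\<Sum>\<pi>\<in>Perm (n - j). weight (n - j) \<pi>)))"
proof -
  define first where "first j = {\<pi> \<in> Perm n. splits \<epsilon> n j \<pi> \<and> (\<forall>i\<in>{1..<j}. \<not> splits \<epsilon> n i \<pi>)}" for j
  have "decomp \<epsilon> n = (\<Union>j\<in>{1..<n}. first j)"
  proof (intro equalityI subsetI)
    fix \<pi> assume \<pi>: "\<pi> \<in> decomp \<epsilon> n"
    define j where "j = (LEAST j. j \<in> {1..<n} \<and> splits \<epsilon> n j \<pi>)"
    have "\<exists>j. j \<in> {1..<n} \<and> splits \<epsilon> n j \<pi>" using \<pi> by (auto simp: decomp_def)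
    from LeastI_ex[OF this] have j: "j \<in> {1..<n}" "splits \<epsilon> n j \<pi>" by (simp_all add: j_def)
    have "\<not> splits \<epsilon> n i \<pi>" if "i \<in> {1..<j}" for i
      using not_less_Least[of i "\<lambda>j. j \<in> {1..<n} \<and> splits \<epsilon> n j \<pi>"] that j(1) by (auto simp: j_def)
    then show "\<pi> \<in> (\<Union>j\<in>{1..<n}. first j)" using j \<pi> by (auto simp: first_def decomp_def)
  qed (auto simp: first_def decomp_def)
  moreover have "first i \<inter> first j = {}" if "i \<in> {1..<n}" "j \<in> {1..<n}" "i \<noteq> j" for i j
    using that by (cases i j rule: linorder_cases) (auto simp: first_def)
  ultimately have "(\<Sum>\<pi>\<in>decomp \<epsilon> n. weight n \<pi>) = (\<Sum>j\<in>{1..<n}. \<Sum>\<pi>\<in>first j. weight n \<pi>)"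
    by (simp add: sum.UNION_disjoint first_def)
  also have "\<dots> = (\<Sum>j\<in>{1..<n}. weight 2 (perm2 \<epsilon>) *
     ((\<Sum>\<pi>\<in>Perm j - decomp \<epsilon> j. weight j \<pi>) * (\<Sum>\<pi>\<in>Perm (n - j). weight (n - j) \<pi>)))"
  proof (rule sum.cong[OF refl])
    fix j assume "j \<in> {1..<n}"
    then have j: "1 \<le> j" "j < n" by auto
    \<comment> \<open>The first component must be indecomposable of the same kind; the second is
      arbitrary.\<close>
    define T where "T i = (if i = 1 then Perm j - decomp \<epsilon> j else Perm (n - j))" for i :: nat
    have card: "card (fiber n (cut n j) 1) = j" "card (fiber n (cut n j) 2) = n - j"
      using fiber_cut[OF j] by simp_all
    have two: "{1..2::nat} = {1, 2}" by auto
    have eq: "first j = {\<pi>. \<pi> \<in> inflations n (cut n j) (perm2 \<epsilon>) \<and> (\<forall>i\<in>{1..2}. component n (cut n j) \<pi> i \<in> T i)}"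
      unfolding inflations_cut[OF j] two first_def
    proof (intro Collect_cong iffI)
      have less: "component n (cut n j) \<pi> 1 p < component n (cut n j) \<pi> 1 q \<longleftrightarrow> \<pi> p < \<pi> q"
        if "p \<in> {1..j}" "q \<in> {1..j}" for p q and \<pi> :: "nat \<Rightarrow> nat"
        using pattern_less_iff[of "{1..j}" "\<lambda>p. p" p q \<pi>] that
        unfolding component_def fiber_cut[OF j] rank_id[OF that(1)] rank_id[OF that(2)] by simp
      \<comment> \<open>The cut at \<open>j\<close> already settles comparisons with positions
        beyond \<open>j\<close>, so an earlier cut can be detected inside the first
        component.\<close>
      have extend: "splits \<epsilon> n i \<pi> \<longleftrightarrow> splits \<epsilon> j i (component n (cut n j) \<pi> 1)"
        if "splits \<epsilon> n j \<pi>" "i \<in> {1..<j}" for i and \<pi> :: "nat \<Rightarrow> nat"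
      proof -
        have "splits \<epsilon> n i \<pi> \<longleftrightarrow> splits \<epsilon> j i \<pi>"
        proof
          assume "splits \<epsilon> j i \<pi>"
          then show "splits \<epsilon> n i \<pi>"
            using that unfolding splits_def by (metis atLeastAtMost_iff atLeastLessThan_iff greaterThanAtMost_iff less_imp_le not_le order_trans)
        qed (use that j in \<open>auto simp: splits_def\<close>)
        also have "\<dots> \<longleftrightarrow> splits \<epsilon> j i (component n (cut n j) \<pi> 1)"
          using less[of _ _ \<pi>] that(2) by (auto simp: splits_def)
        finally show ?thesis .
      qed
      fix \<pi>
      have comp: "component n (cut n j) \<pi> 1 \<in> Perm j" "component n (cut n j) \<pi> 2 \<in> Perm (n - j)" if "\<pi> \<in> Perm n"
        using component_Perm[OF that, of "cut n j" 1] component_Perm[OF that, of "cut n j" 2] card by simp_all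
      show "\<pi> \<in> {\<pi> \<in> Perm n. splits \<epsilon> n j \<pi>} \<and> (\<forall>i\<in>{1, 2}. component n (cut n j) \<pi> i \<in> T i)"
        if "\<pi> \<in> Perm n \<and> splits \<epsilon> n j \<pi> \<and> (\<forall>i\<in>{1..<j}. \<not> splits \<epsilon> n i \<pi>)"
        using that comp extend[of \<pi>] by (auto simp: T_def decomp_def)
      show "\<pi> \<in> Perm n \<and> splits \<epsilon> n j \<pi> \<and> (\<forall>i\<in>{1..<j}. \<not> splits \<epsilon> n i \<pi>)"
        if "\<pi> \<in> {\<pi> \<in> Perm n. splits \<epsilon> n j \<pi>} \<and> (\<forall>i\<in>{1, 2}. component n (cut n j) \<pi> i \<in> T i)"
        using that comp extend[of \<pi>] by (auto simp: T_def decomp_def)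
    qed
    have T: "T i \<subseteq> Perm (card (fiber n (cut n j) i))" if "i \<in> {1..2}" for i
      using that card unfolding two by (auto simp: T_def)
    have "(\<Sum>\<pi>\<in>first j. weight n \<pi>) = weight 2 (perm2 \<epsilon>) *
        (\<Prod>i\<in>{1..2}. \<Sum>\<alpha>\<in>T i. weight (card (fiber n (cut n j) i)) \<alpha>)"
      unfolding eq by (rule sum_weight_inflations[OF cut_mono_surj[OF j] perm2_Perm T])
    also have "(\<Prod>i\<in>{1..2}. \<Sum>\<alpha>\<in>T i. weight (card (fiber n (cut n j) i)) \<alpha>) =
        (\<Sum>\<pi>\<in>Perm j - decomp \<epsilon> j. weight j \<pi>) * (\<Sum>\<pi>\<in>Perm (n - j). weight (n - j) \<pi>)"
      unfolding two using card by (simp add: T_def)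
    finally show "(\<Sum>\<pi>\<in>first j. weight n \<pi>) = weight 2 (perm2 \<epsilon>) *
      ((\<Sum>\<pi>\<in>Perm j - decomp \<epsilon> j. weight j \<pi>) * (\<Sum>\<pi>\<in>Perm (n - j). weight (n - j) \<pi>))" .
  qed
  finally show ?thesis .
qed

section \<open>Maximal blocks\<close>

definition convex_wrt :: "nat \<Rightarrow> (nat \<Rightarrow> nat) \<Rightarrow> nat set \<Rightarrow> bool"
  where "convex_wrt n f A \<longleftrightarrow> (\<forall>p\<in>A. \<forall>q\<in>A. \<forall>r\<in>{1..n} - A. \<not> (f p < f r \<and> f r < f q))"

text \<open>A block as a set of positions that is an interval in both orders. This form treats
  positions and values alike, so each argument about intervals is given once for an arbitrary order
  \<open>f\<close>.\<close>

definition block_set :: "nat \<Rightarrow> (nat \<Rightarrow> nat) \<Rightarrow> nat set \<Rightarrow> bool"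
  where "block_set n \<pi> A \<longleftrightarrow> A \<subseteq> {1..n} \<and> A \<noteq> {} \<and> convex_wrt n (\<lambda>p. p) A \<and> convex_wrt n \<pi> A"

definition joined :: "nat \<Rightarrow> (nat \<Rightarrow> nat) \<Rightarrow> nat \<Rightarrow> nat \<Rightarrow> bool"
  where "joined n \<pi> p q \<longleftrightarrow> (\<exists>A. block_set n \<pi> A \<and> A \<noteq> {1..n} \<and> p \<in> A \<and> q \<in> A)"

lemma convex_wrtD:
  assumes "convex_wrt n f A" "p \<in> A" "q \<in> A" "f p < f r" "f r < f q" "r \<in> {1..n}"
  shows "r \<in> A"
  using assms unfolding convex_wrt_def by (metis DiffI)

lemma convex_wrtI:
  assumes "\<And>p q r. p \<in> A \<Longrightarrow> q \<in> A \<Longrightarrow> r \<in> {1..n} \<Longrightarrow> f p < f r \<Longrightarrow> f r < f q \<Longrightarrow> r \<in> A"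
  shows "convex_wrt n f A"
  unfolding convex_wrt_def using assms by (metis DiffE)

text \<open>A point between elements of the two intervals lies on one side of the common point
  \<open>c\<close>, hence inside one of them.\<close>

lemma convex_wrt_Un:
  assumes "convex_wrt n f A" "convex_wrt n f B" "c \<in> A" "c \<in> B" "inj f"
  shows "convex_wrt n f (A \<union> B)"
proof (rule convex_wrtI)
  fix p q r assume r: "p \<in> A \<union> B" "q \<in> A \<union> B" "r \<in> {1..n}" "f p < f r" "f r < f q"
  consider "f c < f r" | "f r < f c" | "r = c" using assms(5) by (metis injD linorder_neqE_nat)
  then show "r \<in> A \<union> B"
    using convex_wrtD[OF assms(1), of p c r] convex_wrtD[OF assms(2), of p c r]
      convex_wrtD[OF assms(1), of c q r] convex_wrtD[OF assms(2), of c q r] assms(3,4) r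
    by cases blast+
qed

lemma block_set_Un:
  assumes "block_set n \<pi> A" "block_set n \<pi> B" "c \<in> A" "c \<in> B" "\<pi> \<in> Perm n"
  shows "block_set n \<pi> (A \<union> B)"
proof -
  have "inj \<pi>" "inj (\<lambda>p::nat. p)" using Perm_inj[OF assms(5)] by (auto simp: inj_on_def)
  then show ?thesis
    using assms(1-2) convex_wrt_Un[OF _ _ assms(3,4)] unfolding block_set_def by blast
qed

text \<open>The complement of \<open>B\<close> lies in \<open>A\<close>. If it had points on both
  sides of \<open>B\<close>, the interval \<open>A\<close> would contain all of \<open>B\<close> and
  so be everything.\<close>

lemma convex_wrt_side:
  assumes "convex_wrt n f A" "convex_wrt n f B" "inj f" "A \<subset> {1..n}" "A \<union> B = {1..n}"
  shows "(\<forall>r\<in>{1..n} - B. \<forall>q\<in>B. f r < f q) \<or> (\<forall>r\<in>{1..n} - B. \<forall>q\<in>B. f q < f r)"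
proof (rule ccontr)
  assume "\<not> ?thesis"
  then obtain r q r' q' where r: "r \<in> {1..n} - B" "q \<in> B" "\<not> f r < f q"
    "r' \<in> {1..n} - B" "q' \<in> B" "\<not> f q' < f r'" by blast
  have neq: "f x \<noteq> f y" if "x \<in> {1..n} - B" "y \<in> B" for x y using that assms(3) by (auto dest: injD)
  obtain x where x: "x \<in> {1..n}" "x \<notin> A" using assms(4) by blast
  then have "x \<in> B" using assms(5) by blast
  \<comment> \<open>Since \<open>B\<close> is an interval, \<open>r\<close> lies above all of
    \<open>B\<close> and \<open>r'\<close> below all of it, so they enclose the point
    \<open>x\<close> missing from \<open>A\<close>.\<close>
  have "f q < f r" "f r' < f q'" using r neq by (metis linorder_neqE_nat)+
  then have "\<not> f r < f x" "\<not> f x < f r'"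
    using convex_wrtD[OF assms(2), of q x r] convex_wrtD[OF assms(2), of x q' r'] r \<open>x \<in> B\<close> by blast+
  then have "f x < f r" using r(1) neq[of r x] \<open>x \<in> B\<close> by (metis linorder_neqE_nat)
  moreover have "f r' < f x"
    using \<open>\<not> f x < f r'\<close> r(4) neq[of r' x] \<open>x \<in> B\<close> by (metis linorder_neqE_nat)
  moreover have "r \<in> A" "r' \<in> A" using r(1,4) unfolding assms(5)[symmetric] by blast+
  ultimately show False using convex_wrtD[OF assms(1), of r' r x] x by blast
qed

text \<open>\<open>L\<close> precedes \<open>R\<close> and they exhaust the positions, so the cut is
  at the last element of \<open>L\<close>.\<close>

lemma decompI:
  assumes "\<pi> \<in> Perm n" "L \<union> R = {1..n}" "L \<noteq> {}" "R \<noteq> {}"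
    and "\<And>l r. l \<in> L \<Longrightarrow> r \<in> R \<Longrightarrow> l < r" "\<And>l r. l \<in> L \<Longrightarrow> r \<in> R \<Longrightarrow> (\<pi> l < \<pi> r) = \<epsilon>"
  shows "\<pi> \<in> decomp \<epsilon> n"
proof -
  have fin: "finite L" using assms(2) by (metis finite_Un finite_atLeastAtMost)
  define j where "j = Max L"
  have j: "j \<in> L" "\<And>l. l \<in> L \<Longrightarrow> l \<le> j" using fin assms(3) by (auto simp: j_def)
  have sub: "L \<subseteq> {1..n}" "R \<subseteq> {1..n}" and cases: "p \<in> L \<or> p \<in> R" if "p \<in> {1..n}" for p
    using assms(2) that by blast+
  obtain r where r: "r \<in> R" using assms(4) by blast
  have "{1..n} \<noteq> {}" using assms(2,3) by blast
  then have n: "n \<in> {1..n}" by simp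
  have jn: "1 \<le> j" "j < n" using subsetD[OF sub(1)[OF n] j(1)] subsetD[OF sub(2)[OF n] r] assms(5)[OF j(1) r] by simp_all
  have L: "p \<in> L" if "p \<in> {1..j}" for p
    using cases[of p] assms(5)[OF j(1), of p] that jn by (auto simp: less_le_not_le)
  have R: "p \<in> R" if "p \<in> {j<..n}" for p
    using cases[of p] j(2)[of p] that jn by auto
  have "j \<in> {1..<n}" using jn by simp
  moreover have "splits \<epsilon> n j \<pi>" unfolding splits_def using L R assms(6) by blast
  ultimately show ?thesis using assms(1) by (auto simp: decomp_def)
qed

text \<open>The complement \<open>C\<close> of \<open>B\<close> lies on a single side of
  \<open>B\<close> both in position and in value, so \<open>B\<close> and \<open>C\<close> are the
  two summands of a direct or a skew sum.\<close>

lemma block_cover_decomp: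
  assumes \<pi>: "\<pi> \<in> Perm n" and A: "block_set n \<pi> A" "A \<noteq> {1..n}" and B: "block_set n \<pi> B" "B \<noteq> {1..n}"
    and AB: "A \<union> B = {1..n}"
  shows "\<exists>\<epsilon>. \<pi> \<in> decomp \<epsilon> n"
proof -
  define C where "C = {1..n} - B"
  have C: "C \<noteq> {}" "C \<union> B = {1..n}" "B \<union> C = {1..n}" "B \<noteq> {}" using B by (auto simp: C_def block_set_def)
  have cv: "convex_wrt n (\<lambda>p. p) A" "convex_wrt n \<pi> A" "convex_wrt n (\<lambda>p. p) B" "convex_wrt n \<pi> B" "A \<subset> {1..n}"
    using A B by (auto simp: block_set_def)
  have inj: "inj \<pi>" "inj (\<lambda>p::nat. p)" using Perm_inj[OF \<pi>] by (auto simp: inj_on_def)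
  have 1: "(\<forall>r\<in>C. \<forall>q\<in>B. r < q) \<or> (\<forall>r\<in>C. \<forall>q\<in>B. q < r)"
    using convex_wrt_side[OF cv(1,3) inj(2) cv(5) AB] unfolding C_def .
  have 2: "(\<forall>r\<in>C. \<forall>q\<in>B. \<pi> r < \<pi> q) \<or> (\<forall>r\<in>C. \<forall>q\<in>B. \<pi> q < \<pi> r)"
    using convex_wrt_side[OF cv(2,4) inj(1) cv(5) AB] unfolding C_def .
  have 3: "\<exists>\<epsilon>. \<forall>r\<in>C. \<forall>q\<in>B. (\<pi> r < \<pi> q) = \<epsilon>" "\<exists>\<epsilon>. \<forall>r\<in>C. \<forall>q\<in>B. (\<pi> q < \<pi> r) = \<epsilon>"
    using 2 by (meson less_asym)+
  show ?thesis
    using 1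
  proof
    assume "\<forall>r\<in>C. \<forall>q\<in>B. r < q"
    then show ?thesis using decompI[OF \<pi> C(2) C(1) C(4)] 3(1) by metis
  next
    assume "\<forall>r\<in>C. \<forall>q\<in>B. q < r"
    then show ?thesis using decompI[OF \<pi> C(3) C(4) C(1)] 3(2) by metis
  qed
qed

lemma joined_refl:
  assumes "2 \<le> n" "p \<in> {1..n}"
  shows "joined n \<pi> p p"
proof -
  have "card {p} \<noteq> card {1..n}" using assms(1) by simp
  then have "{p} \<noteq> {1..n}" by (rule contrapos_nn) (rule arg_cong)
  moreover have "block_set n \<pi> {p}" using assms(2) by (auto simp: block_set_def convex_wrt_def)
  ultimately show ?thesis unfolding joined_def by blast
qed

lemma joined_sym: "joined n \<pi> p q \<Longrightarrow> joined n \<pi> q p"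
  unfolding joined_def by blast

text \<open>The union of two overlapping proper blocks is again a block, and it is proper because a
  cover by two proper blocks would decompose \<open>\<pi>\<close>.\<close>

lemma joined_trans:
  assumes "\<pi> \<in> Perm n" "\<And>\<epsilon>. \<pi> \<notin> decomp \<epsilon> n" "joined n \<pi> p q" "joined n \<pi> q r"
  shows "joined n \<pi> p r"
proof -
  obtain A B where A: "block_set n \<pi> A" "A \<noteq> {1..n}" "p \<in> A" "q \<in> A"
    and B: "block_set n \<pi> B" "B \<noteq> {1..n}" "q \<in> B" "r \<in> B" using assms(3,4) unfolding joined_def by blast
  have "block_set n \<pi> (A \<union> B)" using block_set_Un A B assms(1) by blast
  moreover have "A \<union> B \<noteq> {1..n}" using block_cover_decomp[OF assms(1) A(1,2) B(1,2)] assms(2) by blast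
  ultimately show ?thesis unfolding joined_def using A B by blast
qed

lemma joined_mem: "joined n \<pi> p q \<Longrightarrow> p \<in> {1..n} \<and> q \<in> {1..n}"
  unfolding joined_def block_set_def by blast

lemma joined_between:
  assumes "joined n \<pi> p q" "r \<in> {1..n}" "(p < r \<and> r < q) \<or> (\<pi> p < \<pi> r \<and> \<pi> r < \<pi> q)"
  shows "joined n \<pi> p r"
  using assms unfolding joined_def block_set_def by (metis convex_wrtD)

section \<open>Monotone surjections and their quotients\<close>

lemma mono_surj_of_equiv:
  assumes refl: "\<And>p. p \<in> {1..n} \<Longrightarrow> E p p" and sym: "\<And>p q. E p q \<Longrightarrow> E q p"
    and trans: "\<And>p q r. E p q \<Longrightarrow> E q r \<Longrightarrow> E p r"
    and between: "\<And>p q r. E p q \<Longrightarrow> p < r \<Longrightarrow> r < q \<Longrightarrow> E p r"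
  shows "\<exists>k. \<exists>b\<in>mono_surj n k. \<forall>p\<in>{1..n}. \<forall>q\<in>{1..n}. b p = b q \<longleftrightarrow> E p q"
proof -
  \<comment> \<open>The classes are intervals, so numbering them by the rank of their least elements
    is monotone.\<close>
  define m where "m p = (LEAST q. q \<in> {1..n} \<and> E p q)" for p
  have m: "m p \<in> {1..n}" "E p (m p)" "m p \<le> p" if "p \<in> {1..n}" for p
    using LeastI[of "\<lambda>q. q \<in> {1..n} \<and> E p q" p] Least_le[of "\<lambda>q. q \<in> {1..n} \<and> E p q" p] refl[OF that] that
    by (auto simp: m_def)
  have m_eq: "m p = m q \<longleftrightarrow> E p q" if "p \<in> {1..n}" "q \<in> {1..n}" for p q
  proof
    assume "m p = m q"
    then show "E p q" using m(2)[OF that(1)] m(2)[OF that(2)] sym trans by metis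
  next
    assume "E p q"
    then have "(\<lambda>r. r \<in> {1..n} \<and> E p r) = (\<lambda>r. r \<in> {1..n} \<and> E q r)" using sym trans by (intro ext) blast
    then show "m p = m q" by (simp add: m_def)
  qed
  have m_mono: "m p \<le> m q" if "p \<in> {1..n}" "q \<in> {1..n}" "p \<le> q" for p q
  proof (rule ccontr)
    assume "\<not> m p \<le> m q"
    then have lt: "m q < p" using m(3)[OF that(1)] by simp
    have "E (m q) q" using m(2)[OF that(2)] sym by blast
    \<comment> \<open>\<open>p\<close> lies between the least element of the class of
      \<open>q\<close> and \<open>q\<close> itself, hence in that class.\<close>
    then have "E (m q) p" using between[of "m q" q p] lt that(3) by (cases "p = q") auto
    then have "E p q" using \<open>E (m q) q\<close> sym trans by blast
    then show False using m_eq[OF that(1,2)] \<open>\<not> m p \<le> m q\<close> by simp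
  qed
  define M where "M = m ` {1..n}"
  have fin: "finite M" by (simp add: M_def)
  have bij: "bij_betw (rank M (\<lambda>x. x)) M {1..card M}" by (rule rank_bij) (auto simp: fin)
  define b where "b = (\<lambda>p\<in>{1..n}. rank M (\<lambda>x. x) (m p))"
  have "b ` {1..n} = {1..card M}"
    using bij by (auto simp: b_def M_def bij_betw_def image_image)
  moreover have "mono_on {1..n} b"
  proof (rule monotone_onI)
    fix p q assume "p \<in> {1..n}" "q \<in> {1..n}" "p \<le> q"
    then show "b p \<le> b q"
      using rank_less_iff[OF fin, of "m q" "m p" "\<lambda>x. x"] m_mono[of p q] by (auto simp: b_def M_def not_less[symmetric])
  qed
  ultimately have "b \<in> mono_surj n (card M)" by (auto simp: mono_surj_def b_def)
  moreover have "b p = b q \<longleftrightarrow> E p q" if "p \<in> {1..n}" "q \<in> {1..n}" for p q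
  proof -
    have "b p = b q \<longleftrightarrow> m p = m q"
      using that bij unfolding b_def M_def bij_betw_def by (auto dest: inj_onD)
    then show ?thesis using m_eq[OF that] by simp
  qed
  ultimately show ?thesis by blast
qed

lemma mono_surj_image:
  assumes "b \<in> mono_surj n k" "p \<in> {1..n}"
  shows "b ` {1..p} = {1..b p}"
proof (intro equalityI subsetI)
  have mono: "b x \<le> b y" if "x \<in> {1..n}" "y \<in> {1..n}" "x \<le> y" for x y
    using assms(1) that by (auto simp: mono_surj_def monotone_on_def)
  have im: "b ` {1..n} = {1..k}" using assms(1) by (simp add: mono_surj_def)
  show "x \<in> {1..b p}" if x: "x \<in> b ` {1..p}" for x
  proof -
    obtain q where q: "q \<in> {1..p}" "x = b q" using x by blast
    then have "b q \<in> {1..k}" using im assms(2) by auto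
    then show ?thesis using mono[of q p] q assms(2) by auto
  qed
  fix x assume x: "x \<in> {1..b p}"
  have "b p \<in> {1..k}" using im assms(2) by blast
  then have "x \<in> b ` {1..n}" using x unfolding im by auto
  then obtain q where q: "q \<in> {1..n}" "x = b q" by blast
  show "x \<in> b ` {1..p}"
  proof (cases "q \<le> p")
    case False
    then have "b q = b p" using mono[of p q] q assms(2) x by auto
    moreover have "p \<in> {1..p}" using assms(2) by simp
    ultimately show ?thesis unfolding q(2) by blast
  qed (use q in auto)
qed

text \<open>By \<open>mono_surj_image\<close>, \<open>b p\<close> is the number of distinct values
  of \<open>b\<close> on \<open>{1..p}\<close>, and this depends only on which positions share a
  block.\<close>

lemma mono_surj_eqI:
  assumes b: "b \<in> mono_surj n k" and b': "b' \<in> mono_surj n k'"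
    and eq: "\<And>p q. p \<in> {1..n} \<Longrightarrow> q \<in> {1..n} \<Longrightarrow> b p = b q \<longleftrightarrow> b' p = b' q"
  shows "b = b'" "k = k'"
proof -
  have "b p = b' p" if p: "p \<in> {1..n}" for p
  proof -
    \<comment> \<open>Translates values of \<open>b\<close> into values of \<open>b'\<close>;
      equality of the kernels makes it well defined and injective.\<close>
    define g where "g x = b' (SOME q. q \<in> {1..n} \<and> b q = x)" for x
    have g: "g (b q) = b' q" if "q \<in> {1..n}" for q
    proof -
      have "(SOME r. r \<in> {1..n} \<and> b r = b q) \<in> {1..n} \<and> b (SOME r. r \<in> {1..n} \<and> b r = b q) = b q"
        by (rule someI[of _ q]) (use that in simp)
      then show ?thesis using eq that unfolding g_def by blast
    qed
    have sub: "{1..p} \<subseteq> {1..n}" using p by auto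
    have "g ` (b ` {1..p}) = b' ` {1..p}" using g sub by (force simp: image_image)
    moreover have "inj_on g (b ` {1..p})" using g sub eq by (auto simp: inj_on_def subset_iff)
    ultimately have "card (b ` {1..p}) = card (b' ` {1..p})" by (metis card_image)
    then show ?thesis using mono_surj_image[OF b p] mono_surj_image[OF b' p] by simp
  qed
  moreover have "b \<in> extensional {1..n}" "b' \<in> extensional {1..n}" using b b' by (auto simp: mono_surj_def PiE_def)
  ultimately show "b = b'" by (intro extensionalityI) auto
  then have "{1..k} = {1..k'}" using b b' by (auto simp: mono_surj_def)
  then show "k = k'" by (metis card_atLeastAtMost diff_Suc_1)
qed

lemma inflations_less_iff:
  assumes "\<pi> \<in> inflations n b \<sigma>" "p \<in> {1..n}" "q \<in> {1..n}" "b p \<noteq> b q"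
  shows "\<pi> p < \<pi> q \<longleftrightarrow> \<sigma> (b p) < \<sigma> (b q)"
  using assms unfolding inflations_def by blast

lemma mono_surj_mem: "b \<in> mono_surj n k \<Longrightarrow> p \<in> {1..n} \<Longrightarrow> b p \<in> {1..k}"
  unfolding mono_surj_def by (simp only: mem_Collect_eq PiE_iff)

lemma mono_surj_obtain:
  assumes "b \<in> mono_surj n k" "i \<in> {1..k}"
  obtains p where "p \<in> {1..n}" "b p = i"
proof -
  have "i \<in> b ` {1..n}" using assms by (simp add: mono_surj_def)
  then show thesis using that by blast
qed

lemma inflations_unique:
  assumes b: "b \<in> mono_surj n k" and "\<sigma> \<in> Perm k" "\<tau> \<in> Perm k" "\<pi> \<in> inflations n b \<sigma>" "\<pi> \<in> inflations n b \<tau>"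
  shows "\<sigma> = \<tau>"
proof (rule permutes_eqI_order)
  show "\<sigma> permutes {1..k}" "\<tau> permutes {1..k}" using assms by (simp_all add: Perm_def)
  fix i j assume ij: "i \<in> {1..k}" "j \<in> {1..k}" "i \<noteq> j"
  then obtain p q where "p \<in> {1..n}" "b p = i" "q \<in> {1..n}" "b q = j" using mono_surj_obtain[OF b] by metis
  then show "\<sigma> i < \<sigma> j \<longleftrightarrow> \<tau> i < \<tau> j"
    using inflations_less_iff[OF assms(4), of p q] inflations_less_iff[OF assms(5), of p q] ij by simp
qed

text \<open>When blocks are intervals of values, comparing two blocks does not depend on the chosen
  elements. The quotient is thus the pattern of one representative per block.\<close>

lemma inflations_exists:
  assumes b: "b \<in> mono_surj n k" and \<pi>: "\<pi> \<in> Perm n"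
    and cv: "\<And>i. i \<in> {1..k} \<Longrightarrow> convex_wrt n \<pi> (fiber n b i)"
  shows "\<exists>\<sigma>\<in>Perm k. \<pi> \<in> inflations n b \<sigma>"
proof -
  define rep where "rep i = (SOME p. p \<in> fiber n b i)" for i
  have rep: "rep i \<in> {1..n}" "b (rep i) = i" if "i \<in> {1..k}" for i
  proof -
    have "\<exists>p. p \<in> fiber n b i" using mono_surj_obtain[OF b that] by (auto simp: fiber_def)
    then have "rep i \<in> fiber n b i" unfolding rep_def by (rule someI_ex)
    then show "rep i \<in> {1..n}" "b (rep i) = i" by (auto simp: fiber_def)
  qed
  have inj: "inj \<pi>" using Perm_inj[OF \<pi>] .
  define \<sigma> where "\<sigma> = pattern {1..k} (\<lambda>i. i) (\<pi> \<circ> rep)"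
  have "inj_on (\<pi> \<circ> rep) {1..k}"
  proof (rule inj_onI)
    fix i j assume ij: "i \<in> {1..k}" "j \<in> {1..k}" "(\<pi> \<circ> rep) i = (\<pi> \<circ> rep) j"
    then have "rep i = rep j" using inj by (auto dest: injD)
    then show "i = j" using rep(2) ij by metis
  qed
  then have "\<sigma> permutes {1..card {1..k}}" unfolding \<sigma>_def by (intro pattern_permutes) auto
  then have \<sigma>: "\<sigma> \<in> Perm k" by (simp add: Perm_def)
  have \<sigma>_less: "\<sigma> i < \<sigma> j \<longleftrightarrow> \<pi> (rep i) < \<pi> (rep j)" if "i \<in> {1..k}" "j \<in> {1..k}" for i j
    using pattern_less_iff[of "{1..k}" "\<lambda>i. i" i j "\<pi> \<circ> rep"] that
    unfolding \<sigma>_def rank_id[OF that(1)] rank_id[OF that(2)] by simp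
  \<comment> \<open>A position may be replaced by another one of its block in any comparison with a
    position outside the block.\<close>
  have move: "\<pi> p < \<pi> r \<longleftrightarrow> \<pi> q < \<pi> r"
    if "p \<in> {1..n}" "q \<in> {1..n}" "r \<in> {1..n}" "b p = b q" "b r \<noteq> b p" for p q r
  proof -
    have mem: "p \<in> fiber n b (b p)" "q \<in> fiber n b (b p)" "r \<notin> fiber n b (b p)" using that by (auto simp: fiber_def)
    have "\<pi> p \<noteq> \<pi> r" "\<pi> q \<noteq> \<pi> r" using that inj by (auto dest: injD)
    then show ?thesis
      using convex_wrtD[OF cv[OF mono_surj_mem[OF b that(1)]], of p q r]
        convex_wrtD[OF cv[OF mono_surj_mem[OF b that(1)]], of q p r] mem that(3)
      by (metis linorder_neqE_nat)
  qed
  have "\<pi> p < \<pi> q \<longleftrightarrow> \<sigma> (b p) < \<sigma> (b q)" if pq: "p \<in> {1..n}" "q \<in> {1..n}" "b p \<noteq> b q" for p q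
  proof -
    have k: "b p \<in> {1..k}" "b q \<in> {1..k}" using mono_surj_mem[OF b] pq by blast+
    have r: "rep (b p) \<in> {1..n}" "b (rep (b p)) = b p" "rep (b q) \<in> {1..n}" "b (rep (b q)) = b q"
      using rep k by blast+
    have ne: "\<pi> p \<noteq> \<pi> q" "\<pi> (rep (b p)) \<noteq> \<pi> q" "\<pi> (rep (b p)) \<noteq> \<pi> (rep (b q))"
      using pq(3) r inj by (metis injD)+
    have "\<pi> p < \<pi> q \<longleftrightarrow> \<pi> (rep (b p)) < \<pi> q" using move[of p "rep (b p)" q] pq r by simp
    moreover have "\<pi> q < \<pi> (rep (b p)) \<longleftrightarrow> \<pi> (rep (b q)) < \<pi> (rep (b p))"
      using move[of q "rep (b q)" "rep (b p)"] pq r by simp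
    ultimately have "\<pi> p < \<pi> q \<longleftrightarrow> \<pi> (rep (b p)) < \<pi> (rep (b q))" using ne by linarith
    then show ?thesis using \<sigma>_less[OF k] by simp
  qed
  then have "\<pi> \<in> inflations n b \<sigma>" unfolding inflations_def using \<pi> by blast
  then show ?thesis using \<sigma> by blast
qed

section \<open>Simple quotients and uniqueness of the block structure\<close>

lemma convex_id_interval:
  assumes "S \<subseteq> {1..k}" "S \<noteq> {}" "convex_wrt k (\<lambda>p. p) S"
  shows "S = {Min S..Max S}"
proof (intro equalityI subsetI)
  have fin: "finite S" using assms(1) finite_subset by blast
  show "x \<in> {Min S..Max S}" if "x \<in> S" for x using that fin by simp
  fix x assume x: "x \<in> {Min S..Max S}"
  have M: "Min S \<in> S" "Max S \<in> S" using fin assms(2) by auto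
  show "x \<in> S"
  proof (cases "x = Min S \<or> x = Max S")
    case False
    then have "Min S < x" "x < Max S" using x by auto
    moreover have "x \<in> {1..k}" using x M assms(1) by (metis atLeastAtMost_iff order_trans subsetD)
    ultimately show ?thesis using convex_wrtD[OF assms(3) M] by blast
  qed (use M in auto)
qed

text \<open>Carries the absence of proper blocks, stated in \<open>Simp\<close> by end positions and
  value intervals, over to \<open>block_set\<close>.\<close>

lemma Simp_block_set:
  assumes \<sigma>: "\<sigma> \<in> Simp k" and S: "block_set k \<sigma> S"
  shows "(\<exists>x. S = {x}) \<or> S = {1..k}"
proof -
  have P: "\<sigma> permutes {1..k}" using \<sigma> by (simp add: Simp_def)
  have S': "S \<subseteq> {1..k}" "S \<noteq> {}" "convex_wrt k (\<lambda>p. p) S" "convex_wrt k \<sigma> S" using S by (auto simp: block_set_def)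
  have fin: "finite S" using S'(1) finite_subset by blast
  define i j where "i = Min S" and "j = Max S"
  have Sij: "S = {i..j}" unfolding i_def j_def by (rule convex_id_interval[OF S'(1-3)])
  have M: "i \<in> S" "j \<in> S" using fin S'(2) by (auto simp: i_def j_def)
  have ij: "1 \<le> i" "i \<le> j" "j \<le> k" using M S'(1) Sij by auto
  have "\<sigma> ` S \<subseteq> {1..k}" using permutes_image[OF P] S'(1) by blast
  moreover have "convex_wrt k (\<lambda>p. p) (\<sigma> ` S)"
  proof (rule convex_wrtI)
    fix p q r assume r: "p \<in> \<sigma> ` S" "q \<in> \<sigma> ` S" "r \<in> {1..k}" "p < r" "r < q"
    then obtain p' q' where "p' \<in> S" "q' \<in> S" "p = \<sigma> p'" "q = \<sigma> q'" by blast
    moreover obtain r' where "r' \<in> {1..k}" "r = \<sigma> r'" using r(3) permutes_image[OF P] by (metis imageE)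
    ultimately show "r \<in> \<sigma> ` S" using convex_wrtD[OF S'(4), of p' q' r'] r(4,5) by blast
  qed
  ultimately have "\<sigma> ` S = {Min (\<sigma> ` S)..Max (\<sigma> ` S)}" using S'(2) by (intro convex_id_interval) auto
  then have "is_block k \<sigma> i j" unfolding is_block_def using ij Sij by blast
  then have "i = j \<or> (i = 1 \<and> j = k)" using \<sigma> by (auto simp: Simp_def proper_block_def)
  then show ?thesis using Sij by auto
qed

lemma inflations_fiber_block:
  assumes b: "b \<in> mono_surj n k" and \<pi>: "\<pi> \<in> inflations n b \<sigma>" and i: "i \<in> {1..k}"
  shows "block_set n \<pi> (fiber n b i)"
  unfolding block_set_def
proof (intro conjI)
  obtain p where "p \<in> {1..n}" "b p = i" using mono_surj_obtain[OF b i] .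
  then show "fiber n b i \<noteq> {}" by (auto simp: fiber_def)
  show "convex_wrt n (\<lambda>p. p) (fiber n b i)"
  proof (rule convex_wrtI, rule ccontr)
    fix p q r assume r: "p \<in> fiber n b i" "q \<in> fiber n b i" "r \<in> {1..n}" "p < r" "r < q" "r \<notin> fiber n b i"
    then show False using mono_surj_less_iff[OF b, of p r] mono_surj_less_iff[OF b, of r q] by (auto simp: fiber_def)
  qed
  show "convex_wrt n \<pi> (fiber n b i)"
  proof (rule convex_wrtI, rule ccontr)
    fix p q r assume r: "p \<in> fiber n b i" "q \<in> fiber n b i" "r \<in> {1..n}" "\<pi> p < \<pi> r" "\<pi> r < \<pi> q" "r \<notin> fiber n b i"
    then show False using inflations_less_iff[OF \<pi>, of p r] inflations_less_iff[OF \<pi>, of r q] by (auto simp: fiber_def)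
  qed
qed (auto simp: fiber_def)

lemma inflations_joined:
  assumes b: "b \<in> mono_surj n k" and \<pi>: "\<pi> \<in> inflations n b \<sigma>" and k: "2 \<le> k"
    and pq: "p \<in> {1..n}" "q \<in> {1..n}" "b p = b q"
  shows "joined n \<pi> p q"
proof -
  have "fiber n b (b p) \<noteq> {1..n}"
  proof
    assume eq: "fiber n b (b p) = {1..n}"
    have "1 \<in> {1..k}" "2 \<in> {1..k}" using k by auto
    then obtain x y where "x \<in> {1..n}" "b x = 1" "y \<in> {1..n}" "b y = 2" using mono_surj_obtain[OF b] by metis
    then have "x \<in> fiber n b (b p)" "y \<in> fiber n b (b p)" using eq by blast+
    then show False using \<open>b x = 1\<close> \<open>b y = 2\<close> by (simp add: fiber_def)
  qed
  moreover have "p \<in> fiber n b (b p)" "q \<in> fiber n b (b p)" using pq by (auto simp: fiber_def)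
  ultimately show ?thesis
    unfolding joined_def using inflations_fiber_block[OF b \<pi> mono_surj_mem[OF b pq(1)]] by blast
qed

text \<open>If the block of \<open>x\<close> lies strictly between two blocks met by
  \<open>A\<close>, then \<open>x\<close> is in \<open>A\<close>. So for \<open>r\<close> outside
  \<open>A\<close> the block \<open>b r\<close> is never strictly between such blocks, and deleting
  it leaves an interval.\<close>

lemma convex_wrt_image:
  assumes b: "b \<in> mono_surj n k" and A: "convex_wrt n f A" "A \<subseteq> {1..n}"
    and f: "\<And>p q. p \<in> {1..n} \<Longrightarrow> q \<in> {1..n} \<Longrightarrow> b p \<noteq> b q \<Longrightarrow> f p < f q \<longleftrightarrow> g (b p) < g (b q)"
  shows "convex_wrt k g (b ` A)"
    and "r \<in> {1..n} - A \<Longrightarrow> convex_wrt k g (b ` A - {b r})"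
proof -
  have *: "x \<in> A" if "i \<in> b ` A" "j \<in> b ` A" "g i < g (b x)" "g (b x) < g j" "x \<in> {1..n}" for i j x
  proof -
    note x = that
    obtain p q where p: "p \<in> A" "i = b p" and q: "q \<in> A" "j = b q" using x(1,2) by blast
    have "b p \<noteq> b x" "b x \<noteq> b q" using x p q by auto
    moreover have "p \<in> {1..n}" "q \<in> {1..n}" using p q A(2) by blast+
    ultimately have "f p < f x" "f x < f q" using f[of p x] f[of x q] p q x by simp_all
    then show ?thesis by (rule convex_wrtD[OF A(1) p(1) q(1) _ _ x(5)])
  qed
  show "convex_wrt k g (b ` A)"
  proof (rule convex_wrtI)
    fix i j l assume l: "i \<in> b ` A" "j \<in> b ` A" "l \<in> {1..k}" "g i < g l" "g l < g j"
    obtain x where "x \<in> {1..n}" "b x = l" using mono_surj_obtain[OF b l(3)] .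
    then show "l \<in> b ` A" using *[of i j x] l by blast
  qed
  assume r: "r \<in> {1..n} - A"
  show "convex_wrt k g (b ` A - {b r})"
  proof (rule convex_wrtI)
    fix i j l assume l: "i \<in> b ` A - {b r}" "j \<in> b ` A - {b r}" "l \<in> {1..k}" "g i < g l" "g l < g j"
    obtain x where x: "x \<in> {1..n}" "b x = l" using mono_surj_obtain[OF b l(3)] .
    then have "x \<in> A" using *[of i j x] l by blast
    moreover have "l \<noteq> b r" using *[of i j r] l r by blast
    ultimately show "l \<in> b ` A - {b r}" using x by blast
  qed
qed

text \<open>The blocks that were inflated are the maximal proper ones: a proper block \<open>A\<close> meeting all of
  them would leave out some position \<open>r\<close>, and then the complement of the block of \<open>r\<close> would be a
  proper block of \<open>\<sigma>\<close>.\<close>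

lemma joined_imp_same:
  assumes b: "b \<in> mono_surj n k" and \<sigma>: "\<sigma> \<in> Simp k" and \<pi>: "\<pi> \<in> inflations n b \<sigma>" and k: "3 \<le> k"
    and "joined n \<pi> p q"
  shows "b p = b q"
proof -
  obtain A where A: "block_set n \<pi> A" "A \<noteq> {1..n}" "p \<in> A" "q \<in> A" using assms(5) unfolding joined_def by blast
  have A': "A \<subseteq> {1..n}" "convex_wrt n (\<lambda>p. p) A" "convex_wrt n \<pi> A" using A(1) by (auto simp: block_set_def)
  note ord = mono_surj_less_iff[OF b] inflations_less_iff[OF \<pi>]
  have cv: "convex_wrt k (\<lambda>p. p) (b ` A)" "convex_wrt k \<sigma> (b ` A)"
    by (rule convex_wrt_image(1)[OF b A'(2,1) ord(1)], assumption+)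
      (rule convex_wrt_image(1)[OF b A'(3,1) ord(2)], assumption+)
  have cv': "convex_wrt k (\<lambda>p. p) (b ` A - {b r})" "convex_wrt k \<sigma> (b ` A - {b r})" if "r \<in> {1..n} - A" for r
    by (rule convex_wrt_image(2)[OF b A'(2,1) ord(1) that], assumption+)
      (rule convex_wrt_image(2)[OF b A'(3,1) ord(2) that], assumption+)
  have sub: "b ` A \<subseteq> {1..k}" using A'(1) mono_surj_mem[OF b] by blast
  have "block_set k \<sigma> (b ` A)" unfolding block_set_def using sub cv A(3) by blast
  then consider x where "b ` A = {x}" | "b ` A = {1..k}" using Simp_block_set[OF \<sigma>] by blast
  then show ?thesis
  proof cases
    case 1
    then show ?thesis using A(3,4) by (metis imageI singletonD)
  next
    case 2
    obtain r where r: "r \<in> {1..n} - A" using A(2) A'(1) by blast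
    have card: "card ({1..k} - {b r}) = k - 1" using mono_surj_mem[OF b, of r] r by simp
    have "{1..k} - {b r} \<noteq> {}"
    proof
      assume "{1..k} - {b r} = {}"
      then show False using card k by (simp only: card.empty)
    qed
    then have "block_set k \<sigma> ({1..k} - {b r})" unfolding block_set_def using cv'[OF r] unfolding 2 by blast
    then consider x where "{1..k} - {b r} = {x}" | "{1..k} - {b r} = {1..k}" using Simp_block_set[OF \<sigma>] by blast
    then show ?thesis
    proof cases
      case 1
      then have "k - 1 = 1" using card by simp
      then show ?thesis using k by simp
    next
      case 2
      then have "k - 1 = k" using card by simp
      then show ?thesis using k by simp
    qed
  qed
qed

text \<open>Both sides of a cut are proper blocks; one contains the first position and the other the
  last.\<close>

lemma splits_joined:
  assumes \<pi>: "\<pi> \<in> Perm n" and j: "j \<in> {1..<n}" and "splits \<epsilon> n j \<pi>"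
  shows "p \<in> {1..j} \<Longrightarrow> joined n \<pi> 1 p" "p \<in> {j<..n} \<Longrightarrow> joined n \<pi> n p"
proof -
  have sp: "(\<pi> p < \<pi> q) = \<epsilon>" if "p \<in> {1..j}" "q \<in> {j<..n}" for p q using assms(3) that unfolding splits_def by blast
  have inj: "inj \<pi>" using Perm_inj[OF \<pi>] .
  have cmp: "\<pi> q < \<pi> p \<longleftrightarrow> \<not> \<epsilon>" if "p \<in> {1..j}" "q \<in> {j<..n}" for p q
  proof -
    have "p \<noteq> q" using that by simp
    then have "\<pi> p \<noteq> \<pi> q" using inj by (auto dest: injD)
    then show ?thesis using sp[OF that] by linarith
  qed
  have L: "block_set n \<pi> {1..j}" unfolding block_set_def
  proof (intro conjI)
    show "convex_wrt n \<pi> {1..j}"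
    proof (rule convex_wrtI, rule ccontr)
      fix p q r assume r: "p \<in> {1..j}" "q \<in> {1..j}" "r \<in> {1..n}" "\<pi> p < \<pi> r" "\<pi> r < \<pi> q" "r \<notin> {1..j}"
      then have "r \<in> {j<..n}" by auto
      then show False using sp[of p r] cmp[of q r] r by blast
    qed
  qed (use j in \<open>auto simp: convex_wrt_def\<close>)
  have R: "block_set n \<pi> {j<..n}" unfolding block_set_def
  proof (intro conjI)
    show "convex_wrt n \<pi> {j<..n}"
    proof (rule convex_wrtI, rule ccontr)
      fix p q r assume r: "p \<in> {j<..n}" "q \<in> {j<..n}" "r \<in> {1..n}" "\<pi> p < \<pi> r" "\<pi> r < \<pi> q" "r \<notin> {j<..n}"
      then have "r \<in> {1..j}" by auto
      then show False using sp[of r q] cmp[of r p] r by blast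
    qed
  qed (use j in \<open>auto simp: convex_wrt_def\<close>)
  have ne: "{1..j} \<noteq> {1..n}" "{j<..n} \<noteq> {1..n}"
  proof -
    have "n \<in> {1..n}" "n \<notin> {1..j}" "1 \<in> {1..n}" "1 \<notin> {j<..n}" using j by auto
    then show "{1..j} \<noteq> {1..n}" "{j<..n} \<noteq> {1..n}" by blast+
  qed
  have mem: "1 \<in> {1..j}" "n \<in> {j<..n}" using j by auto
  show "p \<in> {1..j} \<Longrightarrow> joined n \<pi> 1 p" unfolding joined_def using L ne(1) mem(1) by blast
  show "p \<in> {j<..n} \<Longrightarrow> joined n \<pi> n p" unfolding joined_def using R ne(2) mem(2) by blast
qed

text \<open>A cut would put every position into the block of 1 or the block of \<open>n\<close>,
  leaving at most two block indices.\<close>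

lemma inflations_not_decomp:
  assumes b: "b \<in> mono_surj n k" and \<sigma>: "\<sigma> \<in> Simp k" and \<pi>: "\<pi> \<in> inflations n b \<sigma>" and k: "3 \<le> k"
  shows "\<pi> \<notin> decomp \<epsilon> n"
proof
  assume "\<pi> \<in> decomp \<epsilon> n"
  then obtain j where P: "\<pi> \<in> Perm n" and j: "j \<in> {1..<n}" "splits \<epsilon> n j \<pi>" by (auto simp: decomp_def)
  have "b p \<in> {b 1, b n}" if "p \<in> {1..n}" for p
  proof (cases "p \<le> j")
    case True
    then show ?thesis using joined_imp_same[OF b \<sigma> \<pi> k splits_joined(1)[OF P j, of p]] that by auto
  next
    case False
    then show ?thesis using joined_imp_same[OF b \<sigma> \<pi> k splits_joined(2)[OF P j, of p]] that by auto
  qed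
  then have "b ` {1..n} \<subseteq> {b 1, b n}" by blast
  then have "{1..k} \<subseteq> {b 1, b n}" using b by (simp add: mono_surj_def)
  then have "card {1..k} \<le> card {b 1, b n}" by (intro card_mono) auto
  also have "\<dots> \<le> 2" by (simp add: card_insert_if)
  finally show False using k by simp
qed

text \<open>Adjacent positions carrying consecutive values form a block of size 2, which is proper
  when \<open>3 \<le> k\<close>.\<close>

lemma Simp_adjacent:
  assumes \<sigma>: "\<sigma> \<in> Simp k" and "3 \<le> k" "1 \<le> i" "Suc i \<le> k"
  shows "\<sigma> (Suc i) \<noteq> Suc (\<sigma> i)" "\<sigma> i \<noteq> Suc (\<sigma> (Suc i))"
proof -
  have im: "\<sigma> ` {i..Suc i} = {\<sigma> i, \<sigma> (Suc i)}" by (simp add: atLeastAtMostSuc_conv insert_commute)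
  have no: "\<sigma> ` {i..Suc i} \<noteq> {a..Suc a}" for a
  proof
    assume "\<sigma> ` {i..Suc i} = {a..Suc a}"
    then have "is_block k \<sigma> i (Suc i)" unfolding is_block_def using assms(3,4) by auto
    then have "proper_block k \<sigma> i (Suc i)" unfolding proper_block_def using assms(2) by auto
    then show False using \<sigma> unfolding Simp_def by blast
  qed
  have interval: "{a..Suc a} = {a, Suc a}" for a by auto
  show "\<sigma> (Suc i) \<noteq> Suc (\<sigma> i)" using no[of "\<sigma> i"] unfolding im interval by auto
  show "\<sigma> i \<noteq> Suc (\<sigma> (Suc i))" using no[of "\<sigma> (Suc i)"] unfolding im interval by auto
qed

text \<open>The middle value would have to differ by 2 from both neighbors, which forces the two
  neighbors to be equal.\<close>

lemma Simp_3: "Simp 3 = {}"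
proof -
  have False if \<sigma>: "\<sigma> \<in> Simp 3" for \<sigma>
  proof -
    have P: "\<sigma> permutes {1..3}" using \<sigma> by (simp add: Simp_def)
    have "\<sigma> i \<in> {1..3}" if "i \<in> {1..3}" for i using permutes_in_image[OF P] that by blast
    from this[of 1] this[of 2] this[of 3]
    have "\<sigma> 1 \<in> {1..3}" "\<sigma> 2 \<in> {1..3}" "\<sigma> 3 \<in> {1..3}" by simp_all
    moreover have "\<sigma> 1 \<noteq> \<sigma> 2" "\<sigma> 1 \<noteq> \<sigma> 3" "\<sigma> 2 \<noteq> \<sigma> 3"
      using permutes_inj[OF P] by (simp_all add: inj_eq)
    moreover have "\<sigma> 2 \<noteq> Suc (\<sigma> 1)" "\<sigma> 1 \<noteq> Suc (\<sigma> 2)" "\<sigma> 3 \<noteq> Suc (\<sigma> 2)" "\<sigma> 2 \<noteq> Suc (\<sigma> 3)"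
      using Simp_adjacent[OF \<sigma>, of 1] Simp_adjacent[OF \<sigma>, of 2]
      by (simp_all add: numeral_2_eq_2 numeral_3_eq_3)
    ultimately show False unfolding atLeastAtMost_iff by linarith
  qed
  then show ?thesis by blast
qed

text \<open>Conversely, in an indecomposable permutation the maximal proper blocks are disjoint, and the
  quotient by them is simple.\<close>

lemma inflations_of_indecomposable:
  assumes \<pi>: "\<pi> \<in> Perm n" and n: "2 \<le> n" and nd: "\<And>\<epsilon>. \<pi> \<notin> decomp \<epsilon> n"
  shows "\<exists>k\<in>{4..n}. \<exists>\<sigma>\<in>Simp k. \<exists>b\<in>mono_surj n k. \<pi> \<in> inflations n b \<sigma>"
proof -
  have inj: "inj \<pi>" using Perm_inj[OF \<pi>] .
  have "\<exists>k. \<exists>b\<in>mono_surj n k. \<forall>p\<in>{1..n}. \<forall>q\<in>{1..n}. b p = b q \<longleftrightarrow> joined n \<pi> p q"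
  proof (rule mono_surj_of_equiv)
    fix p q r assume "joined n \<pi> p q" "p < r" "r < q"
    moreover have "r \<in> {1..n}" using joined_mem[OF \<open>joined n \<pi> p q\<close>] \<open>p < r\<close> \<open>r < q\<close> by auto
    ultimately show "joined n \<pi> p r" using joined_between by blast
  qed (use joined_refl[OF n] joined_sym joined_trans[OF \<pi> nd] in blast)+
  then obtain k b where b: "b \<in> mono_surj n k"
    and eq: "\<And>p q. p \<in> {1..n} \<Longrightarrow> q \<in> {1..n} \<Longrightarrow> b p = b q \<longleftrightarrow> joined n \<pi> p q" by blast
  have cv: "convex_wrt n \<pi> (fiber n b i)" if "i \<in> {1..k}" for i
  proof (rule convex_wrtI)
    fix p q r assume r: "p \<in> fiber n b i" "q \<in> fiber n b i" "r \<in> {1..n}" "\<pi> p < \<pi> r" "\<pi> r < \<pi> q"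
    then have p: "p \<in> {1..n}" "q \<in> {1..n}" "b p = i" "b q = i" by (auto simp: fiber_def)
    then have "joined n \<pi> p q" using eq[of p q] by simp
    then have "joined n \<pi> p r" using joined_between[of n \<pi> p q r] r by blast
    then show "r \<in> fiber n b i" using eq[of p r] p r(3) by (simp add: fiber_def)
  qed
  obtain \<sigma> where \<sigma>: "\<sigma> \<in> Perm k" "\<pi> \<in> inflations n b \<sigma>" using inflations_exists[OF b \<pi> cv] by blast
  have one_n: "1 \<in> {1..n}" "n \<in> {1..n}" using n by auto
  \<comment> \<open>An interval of positions containing both 1 and \<open>n\<close> is everything,
    so there are at least two classes.\<close>
  have "b 1 \<noteq> b n"
  proof
    assume "b 1 = b n"
    then have "joined n \<pi> 1 n" using eq one_n by blast
    then obtain A where A: "block_set n \<pi> A" "A \<noteq> {1..n}" "1 \<in> A" "n \<in> A" unfolding joined_def by blast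
    have "r \<in> A" if "r \<in> {1..n}" for r
    proof (cases "r = 1 \<or> r = n")
      case False
      then have "1 < r" "r < n" using that by auto
      then show ?thesis using A(1) convex_wrtD[of n "\<lambda>p. p" A 1 n r] A(3,4) that unfolding block_set_def by blast
    qed (use A in auto)
    then show False using A(1,2) unfolding block_set_def by blast
  qed
  then have k2: "2 \<le> k"
    using mono_surj_mem[OF b one_n(1)] mono_surj_mem[OF b one_n(2)] by auto
  \<comment> \<open>Two classes would be two proper blocks covering all positions, and
    \<open>\<pi>\<close> would decompose.\<close>
  have "k \<noteq> 2"
  proof
    assume "k = 2"
    have two: "1 \<in> {1..k}" "2 \<in> {1..k}" using k2 by auto
    have bl: "block_set n \<pi> (fiber n b 1)" "block_set n \<pi> (fiber n b 2)"
      using inflations_fiber_block[OF b \<sigma>(2)] two by blast+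
    have "{1..k} = {1, 2}" using \<open>k = 2\<close> by auto
    then have bv: "b p \<in> {1, 2}" if "p \<in> {1..n}" for p using mono_surj_mem[OF b that] by blast
    then have cover: "fiber n b 1 \<union> fiber n b 2 = {1..n}" unfolding fiber_def by blast
    have ne: "fiber n b i \<noteq> {1..n}" for i
    proof
      assume "fiber n b i = {1..n}"
      then have "1 \<in> fiber n b i" "n \<in> fiber n b i" using one_n by blast+
      then show False using \<open>b 1 \<noteq> b n\<close> by (simp add: fiber_def)
    qed
    show False using block_cover_decomp[OF \<pi> bl(1) ne bl(2) ne cover] nd by blast
  qed
  moreover have "\<sigma> \<in> Simp k"
  proof -
    have False if pb: "proper_block k \<sigma> i j" for i j
    proof -
      obtain a c where ij: "1 \<le> i" "i \<le> j" "j \<le> k" "\<sigma> ` {i..j} = {a..c}" "i \<noteq> j" "\<not> (i = 1 \<and> j = k)"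
        using pb unfolding proper_block_def is_block_def by blast
      \<comment> \<open>The union of the classes over a proper block of \<open>\<sigma>\<close> is a
        proper block of \<open>\<pi>\<close>, so it would merge the distinct classes
        \<open>i\<close> and \<open>j\<close>.\<close>
      define A where "A = {p \<in> {1..n}. b p \<in> {i..j}}"
      have "i \<in> {1..k}" "j \<in> {1..k}" using ij by auto
      then obtain p q where p: "p \<in> {1..n}" "b p = i" and q: "q \<in> {1..n}" "b q = j"
        using mono_surj_obtain[OF b] by metis
      have pqA: "p \<in> A" "q \<in> A" using p q ij by (auto simp: A_def)
      have "convex_wrt n (\<lambda>p. p) A"
      proof (rule convex_wrtI)
        fix x y r assume r: "x \<in> A" "y \<in> A" "r \<in> {1..n}" "x < r" "r < y"
        show "r \<in> A"
        proof (cases "b r = b x \<or> b r = b y")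
          case False
          then have "b x < b r" "b r < b y"
            using mono_surj_less_iff[OF b, of x r] mono_surj_less_iff[OF b, of r y] r unfolding A_def by auto
          then show ?thesis using r by (auto simp: A_def)
        qed (use r in \<open>auto simp: A_def\<close>)
      qed
      moreover have "convex_wrt n \<pi> A"
      proof (rule convex_wrtI)
        fix x y r assume r: "x \<in> A" "y \<in> A" "r \<in> {1..n}" "\<pi> x < \<pi> r" "\<pi> r < \<pi> y"
        have xy: "x \<in> {1..n}" "y \<in> {1..n}" "b x \<in> {i..j}" "b y \<in> {i..j}" using r by (auto simp: A_def)
        show "r \<in> A"
        proof (cases "b r = b x \<or> b r = b y")
          case False
          then have "\<sigma> (b x) < \<sigma> (b r)" "\<sigma> (b r) < \<sigma> (b y)"
            using inflations_less_iff[OF \<sigma>(2), of x r] inflations_less_iff[OF \<sigma>(2), of r y] r xy by auto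
          moreover have "\<sigma> (b x) \<in> {a..c}" "\<sigma> (b y) \<in> {a..c}" using ij(4) xy by blast+
          ultimately have "\<sigma> (b r) \<in> \<sigma> ` {i..j}" unfolding ij(4) by auto
          then have "b r \<in> {i..j}" by (simp only: inj_image_mem_iff[OF Perm_inj[OF \<sigma>(1)]])
          then show ?thesis using r by (auto simp: A_def)
        qed (use r xy in \<open>auto simp: A_def\<close>)
      qed
      ultimately have "block_set n \<pi> A" using pqA by (auto simp: block_set_def A_def)
      moreover have "A \<noteq> {1..n}"
      proof
        assume "A = {1..n}"
        then have "b ` {1..n} \<subseteq> {i..j}" by (auto simp: A_def)
        then have "{1..k} \<subseteq> {i..j}" using b by (simp add: mono_surj_def)
        then have "1 \<in> {i..j}" "k \<in> {i..j}" using k2 by auto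
        then show False using ij by auto
      qed
      ultimately have "joined n \<pi> p q" using pqA unfolding joined_def by blast
      then show False using eq[of p q] p q ij(5) by simp
    qed
    then show ?thesis using \<sigma>(1) unfolding Simp_def Perm_def by blast
  qed
  moreover from this have "k \<noteq> 3" using Simp_3 by blast
  moreover have "k \<le> n"
  proof -
    have "card (b ` {1..n}) \<le> card {1..n}" by (rule card_image_le) simp
    then show ?thesis using b by (simp add: mono_surj_def)
  qed
  ultimately show ?thesis using b \<sigma>(2) k2 by (intro bexI[of _ k] bexI[of _ \<sigma>] bexI[of _ b]) auto
qed

section \<open>Gamma expansions\<close>

text \<open>The expansion part of \<open>gamma_positive\<close>, isolated because its closure under
  sums and products can be read off the coefficients.\<close>

definition gamma_nonneg :: "nat \<Rightarrow> real poly poly \<Rightarrow> bool"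
  where "gamma_nonneg d f \<longleftrightarrow> (\<exists>c. (\<forall>(i, j) \<in> gamma_index d. c i j \<ge> 0) \<and>
    f = (\<Sum>(i, j) \<in> gamma_index d. [:[:c i j:]:] * gamma_basis d i j))"

lemma gamma_nonneg_0: "gamma_nonneg d 0"
  unfolding gamma_nonneg_def by (rule exI[of _ "\<lambda>_ _. 0"]) auto

lemma gamma_nonneg_add:
  assumes "gamma_nonneg d f" "gamma_nonneg d g"
  shows "gamma_nonneg d (f + g)"
proof -
  obtain c c' where "\<forall>(i, j) \<in> gamma_index d. c i j \<ge> 0" "\<forall>(i, j) \<in> gamma_index d. c' i j \<ge> 0"
    "f = (\<Sum>(i, j) \<in> gamma_index d. [:[:c i j:]:] * gamma_basis d i j)"
    "g = (\<Sum>(i, j) \<in> gamma_index d. [:[:c' i j:]:] * gamma_basis d i j)"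
    using assms unfolding gamma_nonneg_def by blast
  moreover have "[:[:a + b:]:] * h = [:[:a:]:] * h + [:[:b:]:] * h" for a b :: real and h
    by (simp flip: smult_add_left)
  ultimately show ?thesis unfolding gamma_nonneg_def
    by (intro exI[of _ "\<lambda>i j. c i j + c' i j"]) (auto simp: case_prod_unfold simp flip: sum.distrib)
qed

lemma gamma_nonneg_sum: "(\<And>x. x \<in> A \<Longrightarrow> gamma_nonneg d (f x)) \<Longrightarrow> gamma_nonneg d (sum f A)"
  by (induction A rule: infinite_finite_induct) (auto intro: gamma_nonneg_0 gamma_nonneg_add)

lemma gamma_nonneg_basis:
  assumes "2 * i + j \<le> d" "a \<ge> 0"
  shows "gamma_nonneg d ([:[:a:]:] * gamma_basis d i j)"
proof -
  have "(\<Sum>(i', j') \<in> gamma_index d. [:[:if (i', j') = (i, j) then a else 0:]:] * gamma_basis d i' j')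
    = (\<Sum>x \<in> gamma_index d. if x = (i, j) then [:[:a:]:] * gamma_basis d i j else 0)"
    by (rule sum.cong) (auto split: if_splits)
  also have "\<dots> = [:[:a:]:] * gamma_basis d i j"
    using assms by (subst sum.delta[OF finite_gamma_index]) (auto simp: gamma_index_def)
  finally show ?thesis unfolding gamma_nonneg_def
    using assms by (intro exI[of _ "\<lambda>i' j'. if (i', j') = (i, j) then a else 0"]) auto
qed

text \<open>All three exponents add; the index bounds keep the truncated subtractions exact.\<close>

lemma gamma_basis_mult:
  assumes "2 * i + j \<le> d" "2 * i' + j' \<le> e"
  shows "gamma_basis d i j * gamma_basis e i' j' = gamma_basis (d + e) (i + i') (j + j')"
proof -
  have "d + e - (j + j') - 2 * (i + i') = (d - j - 2 * i) + (e - j' - 2 * i')" using assms by simp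
  then show ?thesis unfolding gamma_basis_def power_add by (simp add: power_add mult_ac)
qed

lemma gamma_nonneg_mult:
  assumes "gamma_nonneg d f" "gamma_nonneg e g"
  shows "gamma_nonneg (d + e) (f * g)"
proof -
  obtain c c' where c: "\<forall>(i, j) \<in> gamma_index d. c i j \<ge> 0" "\<forall>(i, j) \<in> gamma_index e. c' i j \<ge> 0"
    "f = (\<Sum>(i, j) \<in> gamma_index d. [:[:c i j:]:] * gamma_basis d i j)"
    "g = (\<Sum>(i, j) \<in> gamma_index e. [:[:c' i j:]:] * gamma_basis e i j)"
    using assms unfolding gamma_nonneg_def by blast
  have "gamma_nonneg (d + e) (([:[:c i j:]:] * gamma_basis d i j) * ([:[:c' i' j':]:] * gamma_basis e i' j'))"
    if ij: "(i, j) \<in> gamma_index d" "(i', j') \<in> gamma_index e" for i j i' j'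
  proof -
    have "([:[:c i j:]:] * gamma_basis d i j) * ([:[:c' i' j':]:] * gamma_basis e i' j')
      = ([:[:c i j:]:] * [:[:c' i' j':]:]) * (gamma_basis d i j * gamma_basis e i' j')"
      by (simp only: mult_ac)
    also have "\<dots> = [:[:c i j * c' i' j':]:] * gamma_basis (d + e) (i + i') (j + j')"
      using ij by (subst gamma_basis_mult) (auto simp: gamma_index_def)
    also have "gamma_nonneg (d + e) \<dots>"
      using c(1,2) ij by (intro gamma_nonneg_basis mult_nonneg_nonneg) (auto simp: gamma_index_def)
    finally show ?thesis .
  qed
  then show ?thesis unfolding c(3,4) sum_product
    by (intro gamma_nonneg_sum) auto
qed

lemma gamma_nonneg_basis1: "2 * i + j \<le> d \<Longrightarrow> gamma_nonneg d (gamma_basis d i j)"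
  using gamma_nonneg_basis[of i j d 1] by (simp flip: one_pCons)

lemma gamma_nonneg_1: "gamma_nonneg 0 1"
  using gamma_nonneg_basis1[of 0 0 0] by (simp add: gamma_basis_def)

lemma gamma_nonneg_1_plus_st: "gamma_nonneg 1 (1 + var_s * var_t)"
  using gamma_nonneg_basis1[of 0 0 1] by (simp add: gamma_basis_def)

lemma gamma_nonneg_st: "gamma_nonneg 2 (var_s * var_t)"
  using gamma_nonneg_basis1[of 1 0 2] by (simp add: gamma_basis_def)

lemma gamma_nonneg_prod:
  "finite A \<Longrightarrow> (\<And>x. x \<in> A \<Longrightarrow> gamma_nonneg (e x) (f x)) \<Longrightarrow> gamma_nonneg (sum e A) (prod f A)"
  by (induction A rule: finite_induct) (auto intro: gamma_nonneg_1 gamma_nonneg_mult)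

text \<open>Up to degree \<open>N\<close> in \<open>x\<close>, the coefficient of \<open>x ^ m\<close> has darga \<open>m - e\<close>.\<close>

definition gamma_nonneg_fps :: "nat \<Rightarrow> nat \<Rightarrow> real poly poly fps \<Rightarrow> bool"
  where "gamma_nonneg_fps e N G \<longleftrightarrow>
    (\<forall>m\<le>N. if m < e then fps_nth G m = 0 else gamma_nonneg (m - e) (fps_nth G m))"

text \<open>In a nonzero term of the convolution each index is at least the offset of its series, so
  the other factor is needed only up to \<open>M\<close> minus that offset. Hence information on F
  below length n controls the coefficient of F F at n, which drives the induction.\<close>

lemma gamma_nonneg_fps_mult:
  assumes "gamma_nonneg_fps e N G" "gamma_nonneg_fps e' N' H" "e \<le> Suc N" "e' \<le> Suc N'"
    and M: "M \<le> N + e'" "M \<le> N' + e" and e'': "e'' = e + e'"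
  shows "gamma_nonneg_fps e'' M (G * H)"
  unfolding gamma_nonneg_fps_def
proof (intro allI impI)
  fix m assume m: "m \<le> M"
  \<comment> \<open>\<open>e \<le> Suc N\<close> and \<open>e' \<le> Suc N'\<close> put every index
    below an offset into the controlled range, where the coefficient is 0.\<close>
  have zero: "fps_nth G i * fps_nth H (m - i) = 0" if "i < e \<or> m - i < e'" for i
    using assms(1-4) that by (auto simp: gamma_nonneg_fps_def)
  have pos: "gamma_nonneg (m - e'') (fps_nth G i * fps_nth H (m - i))"
    if i: "e \<le> i" "e' \<le> m - i" "i \<le> m" for i
  proof -
    have "gamma_nonneg (i - e) (fps_nth G i)"
      using assms(1) i m M unfolding gamma_nonneg_fps_def by (auto dest!: spec[of _ i])
    moreover have "gamma_nonneg (m - i - e') (fps_nth H (m - i))"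
      using assms(2) i m M unfolding gamma_nonneg_fps_def by (auto dest!: spec[of _ "m - i"])
    moreover have "m - e'' = (i - e) + (m - i - e')" using i e'' by simp
    ultimately show ?thesis using gamma_nonneg_mult by metis
  qed
  show "if m < e'' then fps_nth (G * H) m = 0 else gamma_nonneg (m - e'') (fps_nth (G * H) m)"
  proof (cases "m < e''")
    case True
    then have "fps_nth G i * fps_nth H (m - i) = 0" if "i \<le> m" for i
      using that e'' by (intro zero) linarith
    then show ?thesis using True by (auto simp: fps_mult_nth intro!: sum.neutral)
  next
    case False
    have "gamma_nonneg (m - e'') (fps_nth G i * fps_nth H (m - i))" if "i \<le> m" for i
      using zero[of i] pos[of i] that gamma_nonneg_0 by (metis not_le)
    then show ?thesis using False by (auto simp: fps_mult_nth intro!: gamma_nonneg_sum)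
  qed
qed

section \<open>Integrality of gamma coefficients\<close>

definition int_poly2 :: "real poly poly \<Rightarrow> bool"
  where "int_poly2 f \<longleftrightarrow> (\<forall>a b. coeff (coeff f a) b \<in> \<int>)"

lemma int_poly2_intros:
  "int_poly2 0" "int_poly2 1" "int_poly2 var_s" "int_poly2 var_t"
  "int_poly2 f \<Longrightarrow> int_poly2 g \<Longrightarrow> int_poly2 (f + g)"
  "int_poly2 f \<Longrightarrow> int_poly2 g \<Longrightarrow> int_poly2 (f - g)"
  "int_poly2 f \<Longrightarrow> int_poly2 g \<Longrightarrow> int_poly2 (f * g)"
  "c \<in> \<int> \<Longrightarrow> int_poly2 ([:[:c:]:])"
proof -
  assume "int_poly2 f" "int_poly2 g"
  then show "int_poly2 (f * g)"
    unfolding int_poly2_def coeff_mult coeff_sum by (intro allI Ints_sum Ints_mult) auto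
qed (auto simp: int_poly2_def var_s_def var_t_def coeff_pCons split: nat.split)

lemma int_poly2_power: "int_poly2 f \<Longrightarrow> int_poly2 (f ^ k)"
  by (induction k) (auto intro: int_poly2_intros)

lemma int_poly2_sum: "(\<And>x. x \<in> A \<Longrightarrow> int_poly2 (f x)) \<Longrightarrow> int_poly2 (sum f A)"
  by (induction A rule: infinite_finite_induct) (auto intro: int_poly2_intros)

lemma int_poly2_gamma_basis: "int_poly2 (gamma_basis d i j)"
  unfolding gamma_basis_def by (intro int_poly2_intros int_poly2_power)

text \<open>Multiplication by s t only shifts the coefficients.\<close>

lemma int_poly2_st_cancel:
  assumes "int_poly2 (var_s * var_t * f)"
  shows "int_poly2 f"
proof -
  have "coeff (coeff (var_s * var_t * f) (Suc a)) (Suc b) = coeff (coeff f a) b" for a b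
    by (simp add: var_s_def var_t_def mult.assoc)
  then show ?thesis using assms unfolding int_poly2_def by metis
qed

lemma gamma_basis_Suc:
  "2 \<le> d \<Longrightarrow> gamma_basis d (Suc i) j = var_s * var_t * gamma_basis (d - 2) i j"
proof -
  assume "2 \<le> d"
  then have "d - j - 2 * Suc i = d - 2 - j - 2 * i" by simp
  then show ?thesis by (simp add: gamma_basis_def mult_ac)
qed

lemma eval2_sum: "eval2 (sum f A) a b = (\<Sum>x\<in>A. eval2 (f x) a b)"
  by (induction A rule: infinite_finite_induct) auto

lemma eval2_0_right: "eval2 f a 0 = poly (map_poly (\<lambda>p. coeff p 0) f) a"
  by (induction f) (auto simp: eval2_def map_poly_pCons poly_0_coeff_0)

lemma gamma_index_split:
  "gamma_index d = (\<lambda>j. (0, j)) ` {..d} \<union> (if d < 2 then {} else (\<lambda>(i, j). (Suc i, j)) ` gamma_index (d - 2))"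
  (is "_ = ?R")
proof (intro equalityI subsetI)
  fix x assume x: "x \<in> gamma_index d"
  obtain i j where [simp]: "x = (i, j)" by (cases x)
  show "x \<in> ?R"
  proof (cases i)
    case (Suc k)
    then have "(k, j) \<in> gamma_index (d - 2)" "\<not> d < 2" using x by (auto simp: gamma_index_def)
    then show ?thesis using Suc by force
  qed (use x in \<open>auto simp: gamma_index_def\<close>)
qed (auto simp: gamma_index_def split: if_splits)

lemma sum_gamma_index_split:
  "(\<Sum>(i, j) \<in> gamma_index d. h i j) = (\<Sum>j\<le>d. h 0 j) +
    (if d < 2 then 0 else (\<Sum>(i, j) \<in> gamma_index (d - 2). h (Suc i) j))" for h :: "nat \<Rightarrow> nat \<Rightarrow> real poly poly"
proof -
  let ?A = "(\<lambda>j. (0, j)) ` {..d}"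
  let ?B = "if d < 2 then {} else (\<lambda>(i, j). (Suc i, j)) ` gamma_index (d - 2)"
  have "(\<Sum>(i, j) \<in> gamma_index d. h i j) = (\<Sum>(i, j) \<in> ?A. h i j) + (\<Sum>(i, j) \<in> ?B. h i j)"
    unfolding gamma_index_split[of d] by (intro sum.union_disjoint) auto
  moreover have "(\<Sum>(i, j) \<in> ?A. h i j) = (\<Sum>j\<le>d. h 0 j)"
    by (simp add: sum.reindex inj_on_def)
  moreover have "(\<Sum>(i, j) \<in> (\<lambda>(i, j). (Suc i, j)) ` gamma_index (d - 2). h i j)
      = (\<Sum>(i, j) \<in> gamma_index (d - 2). h (Suc i) j)"
    by (subst sum.reindex) (auto simp: inj_on_def case_prod_unfold)
  ultimately show ?thesis by simp
qed

text \<open>Setting \<open>t = 0\<close> isolates the coefficients with \<open>i = 0\<close>; the remaining terms are divisible by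
  \<open>s * t\<close>, and the quotient has darga \<open>d - 2\<close>.\<close>

lemma gamma_coeffs_int:
  assumes "int_poly2 (\<Sum>(i, j) \<in> gamma_index d. [:[:c i j:]:] * gamma_basis d i j)" "(i, j) \<in> gamma_index d"
  shows "c i j \<in> \<int>"
  using assms
proof (induction d arbitrary: c i j rule: less_induct)
  case (less d)
  let ?f = "\<Sum>(i, j) \<in> gamma_index d. [:[:c i j:]:] * gamma_basis d i j"
  let ?r = "\<Sum>j\<le>d. [:[:c 0 j:]:] * gamma_basis d 0 j"
  define g where "g = (if d < 2 then 0 else
    (\<Sum>(i, j) \<in> gamma_index (d - 2). [:[:c (Suc i) j:]:] * gamma_basis (d - 2) i j))"
  have "(\<Sum>(i, j) \<in> gamma_index (d - 2). [:[:c (Suc i) j:]:] * gamma_basis d (Suc i) j)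
      = var_s * var_t * g" if "\<not> d < 2"
  proof -
    have "[:[:c (Suc i) j:]:] * gamma_basis d (Suc i) j
      = var_s * var_t * ([:[:c (Suc i) j:]:] * gamma_basis (d - 2) i j)" for i j
      using that by (subst gamma_basis_Suc) (simp_all only: not_less mult.left_commute)
    then show ?thesis using that by (simp only: g_def if_False sum_distrib_left case_prod_unfold)
  qed
  then have f: "?f = ?r + var_s * var_t * g"
    by (subst sum_gamma_index_split) (cases "d < 2"; simp add: g_def del: mult_pCons_left)
  have c0: "c 0 j \<in> \<int>" if "j \<le> d" for j
  proof -
    \<comment> \<open>At t = 0 the element \<open>gamma_basis d 0 j\<close> becomes the j-th power
      of s, so \<open>c 0 j\<close> is a coefficient of f(s, 0).\<close>
    have "poly (map_poly (\<lambda>p. coeff p 0) ?f) a = poly (\<Sum>j\<le>d. monom (c 0 j) j) a" for a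
      unfolding eval2_0_right[symmetric] f
      by (simp add: eval2_sum gamma_basis_def poly_sum poly_monom del: mult_pCons_left)
    then have "map_poly (\<lambda>p. coeff p 0) ?f = (\<Sum>j\<le>d. monom (c 0 j) j)"
      by (intro poly_ext)
    then have "coeff (map_poly (\<lambda>p. coeff p 0) ?f) j = c 0 j"
      using that by (simp add: coeff_sum del: mult_pCons_left)
    moreover have "coeff (map_poly (\<lambda>p. coeff p 0) ?f) j \<in> \<int>"
      using less.prems(1) by (simp add: coeff_map_poly int_poly2_def)
    ultimately show ?thesis by simp
  qed
  show ?case
  proof (cases i)
    case 0
    then show ?thesis using c0 less.prems(2) by (auto simp: gamma_index_def)
  next
    case (Suc k)
    then have d: "\<not> d < 2" and k: "(k, j) \<in> gamma_index (d - 2)"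
      using less.prems(2) by (auto simp: gamma_index_def)
    have "int_poly2 ?r"
      by (intro int_poly2_sum int_poly2_intros(7,8) int_poly2_gamma_basis c0) simp
    then have "int_poly2 (?f - ?r)" by (rule int_poly2_intros(6)[OF less.prems(1)])
    then have "int_poly2 (var_s * var_t * g)" unfolding f add_diff_cancel_left' .
    then have "int_poly2 g" by (rule int_poly2_st_cancel)
    then show ?thesis using less.IH[of "d - 2" "\<lambda>i. c (Suc i)" k j] d k Suc
      by (simp add: g_def del: mult_pCons_left)
  qed
qed

lemma gamma_nonneg_nat_coeffs:
  assumes "gamma_nonneg d f" "int_poly2 f"
  shows "\<exists>\<gamma> :: nat \<Rightarrow> nat \<Rightarrow> nat. f = (\<Sum>(i, j) \<in> gamma_index d. of_nat (\<gamma> i j) * gamma_basis d i j)"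
proof -
  obtain c where c: "\<forall>(i, j) \<in> gamma_index d. c i j \<ge> 0"
    "f = (\<Sum>(i, j) \<in> gamma_index d. [:[:c i j:]:] * gamma_basis d i j)"
    using assms(1) unfolding gamma_nonneg_def by blast
  have "of_nat (nat \<lfloor>c i j\<rfloor>) = c i j" if "(i, j) \<in> gamma_index d" for i j
  proof -
    have "c i j \<in> \<int>" by (rule gamma_coeffs_int[OF assms(2)[unfolded c(2)] that])
    then show ?thesis using c(1) that by (auto elim!: Ints_cases)
  qed
  moreover have "(of_nat m :: real poly poly) = [:[:of_nat m:]:]" for m
    by (simp add: of_nat_poly)
  ultimately have "f = (\<Sum>(i, j) \<in> gamma_index d. of_nat (nat \<lfloor>c i j\<rfloor>) * gamma_basis d i j)"
    unfolding c(2) by (intro sum.cong) (auto simp del: mult_pCons_left)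
  then show ?thesis by (intro exI[of _ "\<lambda>i j. nat \<lfloor>c i j\<rfloor>"])
qed

section \<open>Generating functions\<close>

text \<open>For \<open>n \<ge> 1\<close> these are the permutations counted by Y in the
  overview.\<close>

definition indec :: "nat \<Rightarrow> (nat \<Rightarrow> nat) set"
  where "indec n = {\<pi> \<in> Perm n. \<forall>\<epsilon>. \<pi> \<notin> decomp \<epsilon> n}"

definition perm_poly :: "nat \<Rightarrow> real poly poly"
  where "perm_poly n = (\<Sum>\<pi>\<in>Perm n. weight n \<pi>)"

lemma Simp_Perm: "Simp k \<subseteq> Perm k"
  by (auto simp: Simp_def Perm_def)

lemma finite_Simp [simp]: "finite (Simp k)"
  using finite_subset[OF Simp_Perm] by simp

lemma indec_eq:
  assumes "2 \<le> n"
  shows "indec n = (\<Union>(k, b, \<sigma>)\<in>(SIGMA k:{4..n}. mono_surj n k \<times> Simp k). inflations n b \<sigma>)" (is "_ = ?R")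
proof (intro equalityI subsetI)
  fix \<pi> assume "\<pi> \<in> indec n"
  then obtain k \<sigma> b where "k \<in> {4..n}" "\<sigma> \<in> Simp k" "b \<in> mono_surj n k" "\<pi> \<in> inflations n b \<sigma>"
    using inflations_of_indecomposable[of \<pi> n] assms unfolding indec_def by blast
  then show "\<pi> \<in> ?R" by blast
next
  fix \<pi> assume "\<pi> \<in> ?R"
  then obtain k \<sigma> b where "k \<in> {4..n}" "\<sigma> \<in> Simp k" "b \<in> mono_surj n k" and \<pi>: "\<pi> \<in> inflations n b \<sigma>" by blast
  then have "\<pi> \<notin> decomp \<epsilon> n" for \<epsilon> by (intro inflations_not_decomp) auto
  then show "\<pi> \<in> indec n" using \<pi> unfolding indec_def inflations_def by blast
qed

text \<open>Both block maps have the kernel \<open>joined n \<pi>\<close>, which depends on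
  \<open>\<pi>\<close> alone; the block map and then the quotient are thereby determined.\<close>

lemma inflations_disjoint:
  assumes "4 \<le> k" "\<sigma> \<in> Simp k" "b \<in> mono_surj n k" "\<pi> \<in> inflations n b \<sigma>"
    and "4 \<le> k'" "\<sigma>' \<in> Simp k'" "b' \<in> mono_surj n k'" "\<pi> \<in> inflations n b' \<sigma>'"
  shows "k = k' \<and> b = b' \<and> \<sigma> = \<sigma>'"
proof -
  have k: "2 \<le> k" "3 \<le> k" "2 \<le> k'" "3 \<le> k'" using assms(1,5) by auto
  have "b p = b q \<longleftrightarrow> joined n \<pi> p q" if "p \<in> {1..n}" "q \<in> {1..n}" for p q
    using joined_imp_same[OF assms(3,2,4) k(2)] inflations_joined[OF assms(3,4) k(1) that] by blast
  moreover have "b' p = b' q \<longleftrightarrow> joined n \<pi> p q" if "p \<in> {1..n}" "q \<in> {1..n}" for p q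
    using joined_imp_same[OF assms(7,6,8) k(4)] inflations_joined[OF assms(7,8) k(3) that] by blast
  ultimately have "b p = b q \<longleftrightarrow> b' p = b' q" if "p \<in> {1..n}" "q \<in> {1..n}" for p q using that by simp
  from mono_surj_eqI[OF assms(3,7) this] have eq: "b = b'" "k = k'" by blast+
  have "\<sigma> = \<sigma>'"
    using inflations_unique[OF assms(3)] assms(2,4,6,8) eq Simp_Perm by blast
  then show ?thesis using eq by blast
qed

lemma sum_weight_indec:
  assumes "2 \<le> n"
  shows "(\<Sum>\<pi>\<in>indec n. weight n \<pi>) =
    (\<Sum>k\<in>{4..n}. \<Sum>b\<in>mono_surj n k. simp_poly k * (\<Prod>i\<in>{1..k}. perm_poly (card (fiber n b i))))"
proof -
  let ?I = "SIGMA k:{4..n}. mono_surj n k \<times> Simp k"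
  have "(\<Sum>\<pi>\<in>indec n. weight n \<pi>) = (\<Sum>(k, b, \<sigma>)\<in>?I. \<Sum>\<pi>\<in>inflations n b \<sigma>. weight n \<pi>)"
    unfolding indec_eq[OF assms] case_prod_unfold
  proof (rule sum.UNION_disjoint)
    show "\<forall>x\<in>?I. \<forall>y\<in>?I. x \<noteq> y \<longrightarrow>
      inflations n (fst (snd x)) (snd (snd x)) \<inter> inflations n (fst (snd y)) (snd (snd y)) = {}"
    proof (intro ballI impI, rule ccontr)
      fix x y assume xy: "x \<in> ?I" "y \<in> ?I" "x \<noteq> y"
        "inflations n (fst (snd x)) (snd (snd x)) \<inter> inflations n (fst (snd y)) (snd (snd y)) \<noteq> {}"
      obtain k b \<sigma> k' b' \<sigma>' where eq: "x = (k, b, \<sigma>)" "y = (k', b', \<sigma>')" by (metis prod.exhaust)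
      then show False using inflations_disjoint[of k \<sigma> b n _ k' \<sigma>' b'] xy by auto
    qed
  qed auto
  also have "\<dots> = (\<Sum>(k, b, \<sigma>)\<in>?I. weight k \<sigma> * (\<Prod>i\<in>{1..k}. perm_poly (card (fiber n b i))))"
  proof (rule sum.cong[OF refl])
    fix x assume x: "x \<in> ?I"
    obtain k b \<sigma> where eq: "x = (k, b, \<sigma>)" by (metis prod.exhaust)
    then have b: "b \<in> mono_surj n k" and \<sigma>: "\<sigma> \<in> Perm k" using x Simp_Perm by auto
    have "{\<pi>. \<pi> \<in> inflations n b \<sigma> \<and> (\<forall>i\<in>{1..k}. component n b \<pi> i \<in> Perm (card (fiber n b i)))} = inflations n b \<sigma>"
      using component_Perm unfolding inflations_def by blast
    then have "(\<Sum>\<pi>\<in>inflations n b \<sigma>. weight n \<pi>) = weight k \<sigma> * (\<Prod>i\<in>{1..k}. perm_poly (card (fiber n b i)))"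
      using sum_weight_inflations[OF b \<sigma>, of "\<lambda>i. Perm (card (fiber n b i))"] by (simp add: perm_poly_def)
    then show "(case x of (k, b, \<sigma>) \<Rightarrow> \<Sum>\<pi>\<in>inflations n b \<sigma>. weight n \<pi>) =
      (case x of (k, b, \<sigma>) \<Rightarrow> weight k \<sigma> * (\<Prod>i\<in>{1..k}. perm_poly (card (fiber n b i))))" by (simp add: eq)
  qed
  also have "\<dots> = (\<Sum>k\<in>{4..n}. \<Sum>b\<in>mono_surj n k. \<Sum>\<sigma>\<in>Simp k. weight k \<sigma> * (\<Prod>i\<in>{1..k}. perm_poly (card (fiber n b i))))"
    by (subst sum.Sigma[symmetric]) (auto simp: sum.cartesian_product)
  also have "\<dots> = (\<Sum>k\<in>{4..n}. \<Sum>b\<in>mono_surj n k. simp_poly k * (\<Prod>i\<in>{1..k}. perm_poly (card (fiber n b i))))"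
    by (simp add: simp_poly_def weight_def sum_distrib_right)
  finally show ?thesis .
qed

lemma perm_poly_1: "perm_poly 1 = 1" "(\<Sum>\<pi>\<in>indec 1. weight 1 \<pi>) = 1"
proof -
  have "Perm 1 = {id}" by (auto simp: Perm_def permutes_sing)
  moreover have "decomp \<epsilon> 1 = {}" for \<epsilon> by (auto simp: decomp_def)
  moreover have "weight 1 id = 1" by (simp add: weight_def des_def ides_def)
  ultimately show "perm_poly 1 = 1" "(\<Sum>\<pi>\<in>indec 1. weight 1 \<pi>) = 1" by (simp_all add: perm_poly_def indec_def)
qed

text \<open>Every cut separates 1 from \<open>n\<close>, so comparing \<open>\<pi> 1\<close> with
  \<open>\<pi> n\<close> reveals the kind of sum.\<close>

lemma decomp_disjoint: "decomp True n \<inter> decomp False n = {}"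
proof -
  have "(\<pi> 1 < \<pi> n) = \<epsilon>" if "\<pi> \<in> decomp \<epsilon> n" for \<epsilon> \<pi>
    using that by (force simp: decomp_def splits_def)
  then show ?thesis by blast
qed

lemma finite_decomp [simp]: "finite (decomp \<epsilon> n)"
  using finite_subset[OF decomp_subset] by simp

lemma perm_poly_split:
  "perm_poly n = (\<Sum>\<pi>\<in>indec n. weight n \<pi>) + (\<Sum>\<pi>\<in>decomp True n. weight n \<pi>) + (\<Sum>\<pi>\<in>decomp False n. weight n \<pi>)"
proof -
  have "Perm n = indec n \<union> (decomp True n \<union> decomp False n)"
    using decomp_subset by (auto simp: indec_def) (metis (full_types))
  moreover have "indec n \<inter> (decomp True n \<union> decomp False n) = {}" by (auto simp: indec_def)
  ultimately have "perm_poly n = (\<Sum>\<pi>\<in>indec n. weight n \<pi>) + (\<Sum>\<pi>\<in>decomp True n \<union> decomp False n. weight n \<pi>)"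
    unfolding perm_poly_def by (metis finite_Perm finite_Un sum.union_disjoint)
  also have "(\<Sum>\<pi>\<in>decomp True n \<union> decomp False n. weight n \<pi>) =
      (\<Sum>\<pi>\<in>decomp True n. weight n \<pi>) + (\<Sum>\<pi>\<in>decomp False n. weight n \<pi>)"
    by (rule sum.union_disjoint) (simp_all add: decomp_disjoint)
  finally show ?thesis by (simp add: add.assoc)
qed

section \<open>The functional equation and the induction on length\<close>

definition perm_fps :: "real poly poly fps"
  where "perm_fps = Abs_fps (\<lambda>n. if n = 0 then 0 else perm_poly n)"

definition indec_fps :: "real poly poly fps"
  where "indec_fps = Abs_fps (\<lambda>n. if n = 0 then 0 else \<Sum>\<pi>\<in>indec n. weight n \<pi>)"

definition decomp_fps :: "bool \<Rightarrow> real poly poly fps"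
  where "decomp_fps \<epsilon> = Abs_fps (\<lambda>n. \<Sum>\<pi>\<in>decomp \<epsilon> n. weight n \<pi>)"

lemma decomp_fps_eq:
  "decomp_fps \<epsilon> = fps_const (weight 2 (perm2 \<epsilon>)) * ((perm_fps - decomp_fps \<epsilon>) * perm_fps)"
proof (rule fps_ext)
  fix n
  let ?G = "perm_fps - decomp_fps \<epsilon>"
  have d0: "decomp \<epsilon> 0 = {}" by (simp add: decomp_def)
  have G: "fps_nth ?G j = (\<Sum>\<pi>\<in>Perm j - decomp \<epsilon> j. weight j \<pi>)" if "0 < j" for j
    using that sum_diff[OF finite_Perm decomp_subset, of "weight j"]
    by (simp add: perm_fps_def decomp_fps_def perm_poly_def)
  have "fps_nth (?G * perm_fps) n = (\<Sum>j=0..n. fps_nth ?G j * fps_nth perm_fps (n - j))"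
    by (rule fps_mult_nth)
  also have "\<dots> = (\<Sum>j\<in>{1..<n}. fps_nth ?G j * fps_nth perm_fps (n - j))"
  proof (rule sum.mono_neutral_right)
    \<comment> \<open>Both series have constant term 0: the empty permutation, for which
      \<open>perm_poly 0\<close> is 1, must not count as a summand.\<close>
    show "\<forall>j\<in>{0..n} - {1..<n}. fps_nth ?G j * fps_nth perm_fps (n - j) = 0"
    proof
      fix j assume "j \<in> {0..n} - {1..<n}"
      then have "j = 0 \<or> n - j = 0" by auto
      then show "fps_nth ?G j * fps_nth perm_fps (n - j) = 0"
        by (auto simp: perm_fps_def decomp_fps_def d0)
    qed
  qed auto
  also have "\<dots> = (\<Sum>j\<in>{1..<n}. (\<Sum>\<pi>\<in>Perm j - decomp \<epsilon> j. weight j \<pi>) * (\<Sum>\<pi>\<in>Perm (n - j). weight (n - j) \<pi>))"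
  proof (rule sum.cong[OF refl])
    fix j assume "j \<in> {1..<n}"
    then show "fps_nth ?G j * fps_nth perm_fps (n - j) =
      (\<Sum>\<pi>\<in>Perm j - decomp \<epsilon> j. weight j \<pi>) * (\<Sum>\<pi>\<in>Perm (n - j). weight (n - j) \<pi>)"
      using G[of j] by (simp add: perm_fps_def perm_poly_def del: fps_sub_nth)
  qed
  finally show "fps_nth (decomp_fps \<epsilon>) n = fps_nth (fps_const (weight 2 (perm2 \<epsilon>)) * (?G * perm_fps)) n"
    unfolding fps_mult_left_const_nth by (simp only: decomp_fps_def fps_nth_Abs_fps sum_weight_decomp sum_distrib_left)
qed

lemma perm_fps_split: "perm_fps = indec_fps + decomp_fps True + decomp_fps False"
proof (rule fps_ext)
  fix n show "fps_nth perm_fps n = fps_nth (indec_fps + decomp_fps True + decomp_fps False) n"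
    using perm_poly_split[of n] by (simp add: perm_fps_def indec_fps_def decomp_fps_def decomp_def[of _ 0])
qed

text \<open>Multiply the first equation by (1 + F)(1 + u F). The multiples of F F free of Y cancel,
  and the F F F terms, u on the left against 2 u on the right, leave u F F F. No inverse is used, so
  any commutative ring will do.\<close>

lemma clear_denominators:
  fixes F Y P M u :: "'a::comm_ring_1"
  assumes "F = Y + P + M" "P = (F - P) * F" "M = u * ((F - M) * F)"
  shows "F = Y + (1 + u) * (Y * F) + u * (Y * (F * F)) + u * (F * (F * F))"
proof -
  have P: "P * (1 + F) = F * F" using assms(2) by (simp add: algebra_simps)
  have M: "M * (1 + u * F) = u * (F * F)" using assms(3) by (simp add: algebra_simps)
  have "F * ((1 + F) * (1 + u * F)) = Y * ((1 + F) * (1 + u * F)) + P * (1 + F) * (1 + u * F) + M * (1 + u * F) * (1 + F)"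
    by (subst assms(1)) (simp add: algebra_simps)
  then show ?thesis unfolding P M by (simp add: algebra_simps)
qed

lemma perm_fps_rec:
  defines "u \<equiv> fps_const (var_s * var_t)"
  shows "perm_fps = indec_fps + (1 + u) * (indec_fps * perm_fps) + u * (indec_fps * (perm_fps * perm_fps))
    + u * (perm_fps * (perm_fps * perm_fps))"
proof (rule clear_denominators[OF perm_fps_split])
  show "decomp_fps True = (perm_fps - decomp_fps True) * perm_fps"
    by (subst decomp_fps_eq) (simp add: weight_perm2)
  show "decomp_fps False = u * ((perm_fps - decomp_fps False) * perm_fps)"
    by (subst decomp_fps_eq) (simp add: weight_perm2 u_def)
qed

text \<open>The simple quotient has darga k - 1 and a block of size m has darga m - 1; these add up
  to n - 1.\<close>

lemma gamma_nonneg_indec: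
  assumes simple: "\<And>k. k \<ge> 1 \<Longrightarrow> gamma_nonneg (k - 1) (simp_poly k)"
    and IH: "\<And>m. 1 \<le> m \<Longrightarrow> m < n \<Longrightarrow> gamma_nonneg (m - 1) (perm_poly m)" and n: "1 \<le> n"
  shows "gamma_nonneg (n - 1) (\<Sum>\<pi>\<in>indec n. weight n \<pi>)"
proof (cases "n = 1")
  case True
  then show ?thesis using perm_poly_1(2) gamma_nonneg_1 by simp
next
  case False
  have "gamma_nonneg (n - 1) (simp_poly k * (\<Prod>i\<in>{1..k}. perm_poly (card (fiber n b i))))"
    if k: "k \<in> {4..n}" and b: "b \<in> mono_surj n k" for k b
  proof -
    have pos: "1 \<le> card (fiber n b i)" if i: "i \<in> {1..k}" for i
    proof -
      obtain p where "p \<in> {1..n}" "b p = i" using mono_surj_obtain[OF b i] .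
      then have "fiber n b i \<noteq> {}" by (auto simp: fiber_def)
      then show ?thesis by (simp add: Suc_le_eq card_gt_0_iff)
    qed
    have "(\<Union>i\<in>{1..k}. fiber n b i) = {1..n}" using mono_surj_mem[OF b] unfolding fiber_def by blast
    moreover have "card (\<Union>i\<in>{1..k}. fiber n b i) = (\<Sum>i\<in>{1..k}. card (fiber n b i))"
      by (rule card_UN_disjoint) (simp_all add: fiber_def, blast)
    ultimately have total: "(\<Sum>i\<in>{1..k}. card (fiber n b i)) = n" by simp
    \<comment> \<open>Nonemptiness of the blocks makes the truncated subtraction exact.\<close>
    have "(\<Sum>i\<in>{1..k}. card (fiber n b i)) = (\<Sum>i\<in>{1..k}. (card (fiber n b i) - 1) + 1)"
    proof (rule sum.cong[OF refl])
      fix i assume "i \<in> {1..k}"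
      then show "card (fiber n b i) = card (fiber n b i) - 1 + 1" using pos[of i] by simp
    qed
    then have darga: "(\<Sum>i\<in>{1..k}. card (fiber n b i) - 1) + k = n"
      using total by (simp only: sum.distrib) simp
    \<comment> \<open>The sizes minus one add up to n - k with \<open>4 \<le> k\<close>, so the
      induction hypothesis applies to each block.\<close>
    have small: "card (fiber n b i) < n" if i: "i \<in> {1..k}" for i
    proof -
      have "card (fiber n b i) - 1 \<le> (\<Sum>i\<in>{1..k}. card (fiber n b i) - 1)" by (rule member_le_sum[OF i]) auto
      then show ?thesis using darga pos[OF i] k by simp
    qed
    have "gamma_nonneg (\<Sum>i\<in>{1..k}. card (fiber n b i) - 1) (\<Prod>i\<in>{1..k}. perm_poly (card (fiber n b i)))"
      by (intro gamma_nonneg_prod IH pos small) auto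
    then have "gamma_nonneg ((k - 1) + (\<Sum>i\<in>{1..k}. card (fiber n b i) - 1))
        (simp_poly k * (\<Prod>i\<in>{1..k}. perm_poly (card (fiber n b i))))"
      using k by (intro gamma_nonneg_mult simple) auto
    moreover have "(k - 1) + (\<Sum>i\<in>{1..k}. card (fiber n b i) - 1) = n - 1" using darga k by simp
    ultimately show ?thesis by simp
  qed
  then show ?thesis using False n by (subst sum_weight_indec) (auto intro!: gamma_nonneg_sum)
qed

lemma gamma_nonneg_perm_poly:
  assumes simple: "\<And>k. k \<ge> 1 \<Longrightarrow> gamma_nonneg (k - 1) (simp_poly k)" and "1 \<le> n"
  shows "gamma_nonneg (n - 1) (perm_poly n)"
  using assms(2)
proof (induction n rule: less_induct)
  case (less n)
  \<comment> \<open>F is controlled only below \<open>n\<close>, but Y up to \<open>n\<close>. Every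
    product on the right of the recursion has at least two factors without constant term, so its
    coefficient at \<open>n\<close> involves F only below \<open>n\<close>.\<close>
  have F: "gamma_nonneg_fps 1 (n - 1) perm_fps"
    unfolding gamma_nonneg_fps_def perm_fps_def using less by auto
  have Y: "gamma_nonneg_fps 1 n indec_fps"
    unfolding gamma_nonneg_fps_def indec_fps_def
    using gamma_nonneg_indec[OF simple] less by auto
  have YF: "gamma_nonneg_fps 2 n (indec_fps * perm_fps)"
    by (rule gamma_nonneg_fps_mult[OF Y F]) (use less.prems in auto)
  have FF: "gamma_nonneg_fps 2 n (perm_fps * perm_fps)"
    by (rule gamma_nonneg_fps_mult[OF F F]) (use less.prems in auto)
  have YFF: "gamma_nonneg_fps 3 n (indec_fps * (perm_fps * perm_fps))"
    by (rule gamma_nonneg_fps_mult[OF Y FF]) (use less.prems in auto)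
  have FFF: "gamma_nonneg_fps 3 n (perm_fps * (perm_fps * perm_fps))"
    by (rule gamma_nonneg_fps_mult[OF F FF]) (use less.prems in auto)
  \<comment> \<open>A series with offset e + 1 falls short of darga n - 1 by e, which the scalar
    \<open>c\<close> supplies: 1 + s t when e is 1, and s t when e is 2.\<close>
  have scale: "gamma_nonneg (n - 1) (c * fps_nth G n)"
    if "gamma_nonneg_fps (Suc e) n G" "gamma_nonneg e c" for G c e
  proof (cases "n < Suc e")
    case False
    then have "gamma_nonneg (e + (n - Suc e)) (c * fps_nth G n)"
      using that by (intro gamma_nonneg_mult) (auto simp: gamma_nonneg_fps_def)
    then show ?thesis using False by simp
  qed (use that gamma_nonneg_0 in \<open>auto simp: gamma_nonneg_fps_def\<close>)
  let ?u = "var_s * var_t"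
  have "fps_nth perm_fps n = fps_nth indec_fps n + (1 + ?u) * fps_nth (indec_fps * perm_fps) n
    + ?u * fps_nth (indec_fps * (perm_fps * perm_fps)) n + ?u * fps_nth (perm_fps * (perm_fps * perm_fps)) n"
    by (subst perm_fps_rec) (simp only: fps_add_nth fps_mult_left_const_nth distrib_right mult_1)
  moreover have "gamma_nonneg (n - 1) (fps_nth indec_fps n)"
    using Y less.prems by (auto simp: gamma_nonneg_fps_def)
  moreover have "gamma_nonneg (n - 1) ((1 + ?u) * fps_nth (indec_fps * perm_fps) n)"
    by (rule scale[of 1]) (use YF gamma_nonneg_1_plus_st in \<open>simp_all add: numeral_2_eq_2\<close>)
  moreover have "gamma_nonneg (n - 1) (?u * fps_nth (indec_fps * (perm_fps * perm_fps)) n)"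
    "gamma_nonneg (n - 1) (?u * fps_nth (perm_fps * (perm_fps * perm_fps)) n)"
    by (rule scale[of 2]; use YFF FFF gamma_nonneg_st in \<open>simp add: numeral_3_eq_3 numeral_2_eq_2\<close>)+
  ultimately have "gamma_nonneg (n - 1) (fps_nth perm_fps n)" by (simp only: gamma_nonneg_add)
  then show ?case using less.prems by (simp add: perm_fps_def)
qed

lemma int_poly2_perm_poly: "int_poly2 (perm_poly n)"
  unfolding perm_poly_def weight_def by (intro int_poly2_sum int_poly2_intros int_poly2_power)

theorem theorem4p1:
  assumes "\<And>n. n \<ge> 1 \<Longrightarrow> gamma_positive (n - 1) (simp_poly n)"
  shows "\<forall>n \<ge> 1. \<exists>\<gamma> :: nat \<Rightarrow> nat \<Rightarrow> nat.
    (\<Sum>\<pi> | \<pi> permutes {1..n}. var_s ^ des n \<pi> * var_t ^ ides n \<pi>) =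
    (\<Sum>(i, j) \<in> {(i, j). 2 * i + j \<le> n - 1}.
       of_nat (\<gamma> i j) * ((var_s * var_t) ^ i * (var_s + var_t) ^ j *
         (1 + var_s * var_t) ^ (n - 1 - j - 2 * i)))"
proof (intro allI impI)
  fix n :: nat assume n: "1 \<le> n"
  have "gamma_nonneg (k - 1) (simp_poly k)" if "1 \<le> k" for k
    using assms[OF that] by (auto simp: gamma_positive_def gamma_nonneg_def)
  then have "gamma_nonneg (n - 1) (perm_poly n)" using gamma_nonneg_perm_poly n by blast
  then show "\<exists>\<gamma> :: nat \<Rightarrow> nat \<Rightarrow> nat.
    (\<Sum>\<pi> | \<pi> permutes {1..n}. var_s ^ des n \<pi> * var_t ^ ides n \<pi>) =
    (\<Sum>(i, j) \<in> {(i, j). 2 * i + j \<le> n - 1}.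
       of_nat (\<gamma> i j) * ((var_s * var_t) ^ i * (var_s + var_t) ^ j *
         (1 + var_s * var_t) ^ (n - 1 - j - 2 * i)))"
    using gamma_nonneg_nat_coeffs[OF _ int_poly2_perm_poly]
    unfolding perm_poly_def Perm_def weight_def gamma_index_def gamma_basis_def by blast
qed

end
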